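(* Fix an integer $d\ge 2$. For integers $n\ge d$ and $m\ge 2$, let $n$ balls be placed independently into $m$ urns, each ball falling into each urn with probability $1/m$, and let $Y_n$ be the number of urns containing exactly $d$ balls. Let $\mu_{n,m}=E Y_n$ and $\sigma_{n,m}^2=\mathrm{Var}(Y_n)$ (explicitly given in the context), let $$r_{n,m}=\frac{\sigma_{n,m}}{1+(n/m)^3},\qquad W_{n,m}=\frac{Y_n-\mu_{n,m}}{\sigma_{n,m}}.$$ Then there exists a constant $C$ depending only on $d$ such that $$\sup_{z\in\mathbb{R}}\left|P(W_{n,m}\le z)-P(Z\le z)\right|\le \frac{C}{r_{n,m}}\quad\text{for all } n\ge d \text{ and } m\ge 2,$$ where $Z$ is a standard normal random variable.
   Context: Uniform multinomial occupancy model: $n$ balls are distributed independently and uniformly over $m$ urns. For $d\ge 0$, $Y_n$ is the number of urns containing exactly $d$ balls. Its mean and variance are $$\mu_{n,m}=m\binom{n}{d}\frac{1}{m^d}\Big(1-\frac1m\Big)^{n-d},$$ $$\sigma_{n,m}^2=\mu_{n,m}+m(m-1)\binom{n}{d,\,d,\,n-2d}\frac{1}{m^{2d}}\Big(1-\frac2m\Big)^{n-2d}-\mu_{n,m}^2,$$ where the middle term is taken to be $0$ when $d\le n<2d$, and $\binom{n}{d,d,n-2d}=\frac{n!}{d!\,d!\,(n-2d)!}$ is the multinomial coefficient. ($\sigma_{n,m}^2>0$ for all $n\ge d$, $m\ge 2$.) *)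

theory Defs
  imports "HOL-Probability.Probability"
begin

text \<open>Sample space: all assignments of the balls 0..n-1 to urns 0..m-1, uniformly distributed.\<close>
definition occ_space :: "nat \<Rightarrow> nat \<Rightarrow> (nat \<Rightarrow> nat) set" where
  "occ_space n m = {..<n} \<rightarrow>\<^sub>E {..<m}"

definition occY :: "nat \<Rightarrow> nat \<Rightarrow> nat \<Rightarrow> (nat \<Rightarrow> nat) \<Rightarrow> real" where
  "occY n m d f = real (card {u \<in> {..<m}. card {i \<in> {..<n}. f i = u} = d})"

definition occ_mean :: "nat \<Rightarrow> nat \<Rightarrow> nat \<Rightarrow> real" where
  "occ_mean n m d = (\<Sum>f\<in>occ_space n m. occY n m d f) / real (card (occ_space n m))"

definition occ_var :: "nat \<Rightarrow> nat \<Rightarrow> nat \<Rightarrow> real" where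
  "occ_var n m d = (\<Sum>f\<in>occ_space n m. (occY n m d f - occ_mean n m d)^2) / real (card (occ_space n m))"

definition occ_sigma :: "nat \<Rightarrow> nat \<Rightarrow> nat \<Rightarrow> real" where
  "occ_sigma n m d = sqrt (occ_var n m d)"

definition occ_W :: "nat \<Rightarrow> nat \<Rightarrow> nat \<Rightarrow> (nat \<Rightarrow> nat) \<Rightarrow> real" where
  "occ_W n m d f = (occY n m d f - occ_mean n m d) / occ_sigma n m d"

definition occ_cdf :: "nat \<Rightarrow> nat \<Rightarrow> nat \<Rightarrow> real \<Rightarrow> real" where
  "occ_cdf n m d z = real (card {f \<in> occ_space n m. occ_W n m d f \<le> z}) / real (card (occ_space n m))"

definition occ_r :: "nat \<Rightarrow> nat \<Rightarrow> nat \<Rightarrow> real" where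
  "occ_r n m d = occ_sigma n m d / (1 + (real n / real m)^3)"

definition Phi :: "real \<Rightarrow> real" where
  "Phi z = measure (density lborel std_normal_density) {..z}"

end

theory Submission imports Defs
begin

text \<open>
  Let \<open>Z j = (x j, y j)\<close> hold the urn of ball \<open>j\<close> in two independent copies of the experiment. Replacing
  the coordinates of \<open>x\<close> by those of \<open>y\<close> one at a time and swapping the two copies of coordinate \<open>j\<close>
  gives Chatterjee's covariance formula: \<open>Cov (F, G)\<close> is half the sum over \<open>j\<close> of the mean of the change
  of \<open>G\<close> when \<open>x j\<close> is replaced by \<open>y j\<close> times the \<open>j\<close>-th increment of \<open>F\<close> along the interpolation.
  With \<open>G = f (W)\<close>, \<open>f\<close> the solution of Stein's equation for a half line, the derivative of \<open>f\<close> splits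
  into monotone parts, and the argument of Shao and Zhang bounds the Kolmogorov distance by the standard
  deviations of two sums of products of increments, without smoothing and without induction on \<open>n\<close>.

  Those standard deviations are bounded by the Efron-Stein inequality: moving one ball only affects the
  balls that meet one of the urns involved, and moments of their number give a variance of order
  \<open>(1 + n/m)^4\<close> times the mean. The variance of the statistic is at least a constant times the mean:
  group the urns into pairs and flip, within a pair, the ball of a given rank; these commuting
  involutions produce orthogonal differences that correlate with the statistic.
\<close>

section \<open>Averages over finite product spaces\<close>

text \<open>The delicate regime is small n/m. A single move matters if the ball's old urn holds
  \<open>d\<close> or \<open>d + 1\<close> balls, or if its new urn holds \<open>d - 1\<close> or
  \<open>d\<close> other balls. Urns with \<open>d - 1\<close> balls then outnumber those with
  \<open>d\<close> by a factor of order m/n, so counting them bluntly would not be dominated by the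
  mean. They enter only together with a ball that is moved or present elsewhere, and the average
  number of such balls restores the missing factor n/m. This is why \<open>full\<close> and
  \<open>near\<close> urns are kept apart and why the moment bounds carry an explicit factor n/m.

  The counts of two urns are dependent. Instead of a correlation inequality, one uses that, as long
  as a ball avoids urn \<open>v\<close>, the content of \<open>v\<close> does not see which of the
  other m - 1 urns it occupies; conditioning on \<open>v\<close> then costs a factor m/(m - 1), at
  most 2.

  Dividing the standard deviations by the variance leaves \<open>(1 + n/m)^2\<close> over sigma,
  which is below \<open>4 * (1 + (n/m)^3)\<close> over sigma.\<close>

definition avg :: "'a set \<Rightarrow> ('a \<Rightarrow> real) \<Rightarrow> real" where
  "avg A f = (\<Sum>x\<in>A. f x) / real (card A)"

lemma avg_add: "avg A (\<lambda>x. f x + g x) = avg A f + avg A g"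
  by (simp add: avg_def sum.distrib add_divide_distrib)

lemma avg_diff: "avg A (\<lambda>x. f x - g x) = avg A f - avg A g"
  by (simp add: avg_def sum_subtractf diff_divide_distrib)

lemma avg_cmult: "avg A (\<lambda>x. c * f x) = c * avg A f"
  by (simp add: avg_def sum_distrib_left)

lemma avg_cmult_right: "avg A (\<lambda>x. f x * c) = avg A f * c"
  by (simp add: avg_def sum_distrib_right)

lemma avg_uminus: "avg A (\<lambda>x. - f x) = - avg A f"
  by (simp add: avg_def sum_negf)

lemma avg_sum: "avg A (\<lambda>x. \<Sum>i\<in>I. f i x) = (\<Sum>i\<in>I. avg A (f i))"
  unfolding avg_def by (subst sum.swap) (simp add: sum_divide_distrib)

lemma avg_const: "finite A \<Longrightarrow> A \<noteq> {} \<Longrightarrow> avg A (\<lambda>x. c) = c"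
  by (simp add: avg_def)

lemma avg_cong: "(\<And>x. x \<in> A \<Longrightarrow> f x = g x) \<Longrightarrow> avg A f = avg A g"
  by (simp add: avg_def)

lemma avg_mono: "(\<And>x. x \<in> A \<Longrightarrow> f x \<le> g x) \<Longrightarrow> avg A f \<le> avg A g"
  by (simp add: avg_def divide_right_mono sum_mono)

lemma avg_nonneg: "(\<And>x. x \<in> A \<Longrightarrow> 0 \<le> f x) \<Longrightarrow> 0 \<le> avg A f"
  by (simp add: avg_def sum_nonneg)

lemma abs_avg_le: "\<bar>avg A f\<bar> \<le> avg A (\<lambda>x. \<bar>f x\<bar>)"
  by (simp add: avg_def divide_right_mono)

text \<open>The form in which symmetry is used below: swapping copies of coordinates, exchanging two
  urns for one ball, and flipping a ball within a pair of urns are all involutions.\<close>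

lemma avg_involution:
  assumes "\<And>x. x \<in> A \<Longrightarrow> h x \<in> A" "\<And>x. x \<in> A \<Longrightarrow> h (h x) = x"
  shows "avg A (\<lambda>x. f (h x)) = avg A f"
  unfolding avg_def
  by (rule arg_cong[where f = "\<lambda>s. s / _"], rule sum.reindex_bij_witness[where i = h and j = h])
    (use assms in auto)

lemma avg_power2_le:
  assumes "finite A" "A \<noteq> {}"
  shows "(avg A f)\<^sup>2 \<le> avg A (\<lambda>x. (f x)\<^sup>2)"
proof -
  have "0 \<le> avg A (\<lambda>x. (f x - avg A f)\<^sup>2)" by (rule avg_nonneg) simp
  also have "\<dots> = avg A (\<lambda>x. (f x)\<^sup>2 - 2 * avg A f * f x + (avg A f)\<^sup>2)"
    by (rule avg_cong) (simp add: power2_eq_square algebra_simps)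
  also have "\<dots> = avg A (\<lambda>x. (f x)\<^sup>2) - (avg A f)\<^sup>2"
    unfolding avg_add avg_diff avg_cmult avg_const[OF assms] by (simp add: power2_eq_square)
  finally show ?thesis by simp
qed

definition var :: "'a set \<Rightarrow> ('a \<Rightarrow> real) \<Rightarrow> real" where
  "var A f = avg A (\<lambda>x. (f x - avg A f)\<^sup>2)"

lemma var_eq:
  assumes "finite A" "A \<noteq> {}"
  shows "var A f = avg A (\<lambda>x. (f x - avg A f) * f x)"
proof -
  have "var A f = avg A (\<lambda>x. (f x - avg A f) * f x - (f x - avg A f) * avg A f)"
    unfolding var_def by (rule avg_cong) (simp add: power2_eq_square algebra_simps)
  also have "\<dots> = avg A (\<lambda>x. (f x - avg A f) * f x)"
    unfolding avg_diff avg_cmult_right avg_const[OF assms] by simp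
  finally show ?thesis .
qed

lemma avg_abs_dev_le:
  assumes "finite A" "A \<noteq> {}"
  shows "avg A (\<lambda>x. \<bar>f x - avg A f\<bar>) \<le> sqrt (var A f)"
  by (rule real_le_rsqrt)
    (use avg_power2_le[OF assms, of "\<lambda>x. \<bar>f x - avg A f\<bar>"] in \<open>simp add: var_def\<close>)

section \<open>Two independent copies and their hybrids\<close>

definition first_copy :: "nat \<Rightarrow> (nat \<Rightarrow> 'v \<times> 'v) \<Rightarrow> nat \<Rightarrow> 'v" where
  "first_copy n Z = (\<lambda>i\<in>{..<n}. fst (Z i))"

text \<open>Resampled points and hybrids alike are first copies of a swapped configuration, so
  identities in distribution reduce to invariance of the average under swaps.\<close>

definition swap_on :: "nat set \<Rightarrow> (nat \<Rightarrow> 'v \<times> 'v) \<Rightarrow> nat \<Rightarrow> 'v \<times> 'v" where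
  "swap_on A Z = (\<lambda>i. if i \<in> A then prod.swap (Z i) else Z i)"

text \<open>The hybrid whose coordinates below \<open>j\<close> come from the second copy.\<close>
definition hybrid :: "nat \<Rightarrow> nat \<Rightarrow> (nat \<Rightarrow> 'v \<times> 'v) \<Rightarrow> nat \<Rightarrow> 'v" where
  "hybrid n j Z = first_copy n (swap_on {..<j} Z)"

lemma hybrid_0: "hybrid n 0 Z = first_copy n Z"
  by (simp add: hybrid_def swap_on_def)

lemma hybrid_Suc:
  "hybrid n (Suc j) Z = first_copy n (swap_on {j} (swap_on {..<j} Z))"
  unfolding hybrid_def by (rule arg_cong[where f = "first_copy n"]) (auto simp: swap_on_def)

lemma hybrid_swap: "hybrid n j (swap_on {j} Z) = hybrid n (Suc j) Z"
  unfolding hybrid_def by (auto simp: first_copy_def swap_on_def fun_eq_iff)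

lemma hybrid_Suc_swap: "hybrid n (Suc j) (swap_on {j} Z) = hybrid n j Z"
  unfolding hybrid_def by (auto simp: first_copy_def swap_on_def fun_eq_iff)

lemma swap_on_swap_on: "swap_on A (swap_on A Z) = Z"
  by (auto simp: swap_on_def)

lemma swap_on_mem:
  "A \<subseteq> {..<n} \<Longrightarrow> Z \<in> {..<n} \<rightarrow>\<^sub>E V \<times> V \<Longrightarrow> swap_on A Z \<in> {..<n} \<rightarrow>\<^sub>E V \<times> V"
  by (auto simp: swap_on_def PiE_iff extensional_def mem_Times_iff)

lemma first_copy_mem:
  "Z \<in> {..<n} \<rightarrow>\<^sub>E V \<times> V \<Longrightarrow> first_copy n Z \<in> {..<n} \<rightarrow>\<^sub>E V"
  by (auto simp: first_copy_def PiE_iff mem_Times_iff)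

lemma hybrid_mem:
  "j \<le> n \<Longrightarrow> Z \<in> {..<n} \<rightarrow>\<^sub>E V \<times> V \<Longrightarrow> hybrid n j Z \<in> {..<n} \<rightarrow>\<^sub>E V"
  unfolding hybrid_def by (intro first_copy_mem swap_on_mem) auto

lemma avg_swap_on:
  assumes "A \<subseteq> {..<n}"
  shows "avg ({..<n} \<rightarrow>\<^sub>E V \<times> V) (\<lambda>Z. f (swap_on A Z)) = avg ({..<n} \<rightarrow>\<^sub>E V \<times> V) f"
  by (rule avg_involution) (simp_all add: swap_on_mem assms swap_on_swap_on)

lemma avg_copies:
  "avg ({..<n} \<rightarrow>\<^sub>E V \<times> V) (\<lambda>Z. f (first_copy n Z) (hybrid n n Z)) =
     avg ({..<n} \<rightarrow>\<^sub>E V) (\<lambda>x. avg ({..<n} \<rightarrow>\<^sub>E V) (\<lambda>y. f x y))"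
proof -
  have "(\<Sum>Z\<in>{..<n} \<rightarrow>\<^sub>E V \<times> V. f (first_copy n Z) (hybrid n n Z)) =
      (\<Sum>(x, y)\<in>({..<n} \<rightarrow>\<^sub>E V) \<times> ({..<n} \<rightarrow>\<^sub>E V). f x y)"
    by (rule sum.reindex_bij_witness[where j = "\<lambda>Z. (first_copy n Z, hybrid n n Z)"
          and i = "\<lambda>(x, y). \<lambda>i\<in>{..<n}. (x i, y i)"])
      (auto simp: first_copy_mem hybrid_mem first_copy_def hybrid_def swap_on_def fun_eq_iff
        PiE_iff extensional_def mem_Times_iff)
  then show ?thesis
    unfolding avg_def sum_divide_distrib[symmetric] divide_divide_eq_left
    by (simp add: sum.cartesian_product card_PiE card_cartesian_product power_mult_distrib)
qed

text \<open>The increments of \<open>F\<close> telescope from the first copy to the second, and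
  averaging \<open>G x * (F x - F y)\<close> over the independent \<open>y\<close> centres
  \<open>F\<close>. Each increment is odd under the swap of its coordinate, so \<open>G\<close> can
  be antisymmetrised; hence the difference of \<open>G\<close> and the factor 1/2.\<close>

lemma covariance_interpolation:
  assumes fin: "finite V" "V \<noteq> {}"
  shows "avg ({..<n} \<rightarrow>\<^sub>E V) (\<lambda>x. (F x - avg ({..<n} \<rightarrow>\<^sub>E V) F) * G x) =
    (\<Sum>j<n. avg ({..<n} \<rightarrow>\<^sub>E V \<times> V) (\<lambda>Z. (G (first_copy n Z) - G (first_copy n (swap_on {j} Z)))
        * (F (hybrid n j Z) - F (hybrid n (Suc j) Z)))) / 2"
proof -
  let ?P = "{..<n} \<rightarrow>\<^sub>E V" and ?P2 = "{..<n} \<rightarrow>\<^sub>E V \<times> V"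
  let ?D = "\<lambda>j Z. F (hybrid n j Z) - F (hybrid n (Suc j) Z)"
  have ne: "finite ?P" "?P \<noteq> {}" using fin by (auto simp: finite_PiE PiE_eq_empty_iff)
  have term_j: "avg ?P2 (\<lambda>Z. (G (first_copy n Z) - G (first_copy n (swap_on {j} Z))) * ?D j Z)
      = 2 * avg ?P2 (\<lambda>Z. G (first_copy n Z) * ?D j Z)" if j: "j < n" for j
  proof -
    have "avg ?P2 (\<lambda>Z. G (first_copy n (swap_on {j} Z)) * ?D j Z)
        = avg ?P2 (\<lambda>Z. (\<lambda>Z. G (first_copy n Z) * - ?D j Z) (swap_on {j} Z))"
      by (simp add: hybrid_swap hybrid_Suc_swap)
    also have "\<dots> = - avg ?P2 (\<lambda>Z. G (first_copy n Z) * ?D j Z)"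
      by (subst avg_swap_on) (use j in \<open>auto simp: avg_uminus[symmetric] algebra_simps\<close>)
    finally show ?thesis by (simp add: left_diff_distrib avg_diff)
  qed
  have "(\<Sum>j<n. avg ?P2 (\<lambda>Z. (G (first_copy n Z) - G (first_copy n (swap_on {j} Z))) * ?D j Z)) / 2
      = avg ?P2 (\<lambda>Z. \<Sum>j<n. G (first_copy n Z) * ?D j Z)"
    unfolding avg_sum by (simp add: term_j sum_distrib_left[symmetric])
  also have "\<dots> = avg ?P2 (\<lambda>Z. G (first_copy n Z) * (F (first_copy n Z) - F (hybrid n n Z)))"
    by (simp add: sum_distrib_left[symmetric] sum_lessThan_telescope'[of "\<lambda>j. F (hybrid n j _)"] hybrid_0)
  also have "\<dots> = avg ?P (\<lambda>x. avg ?P (\<lambda>y. G x * (F x - F y)))"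
    by (rule avg_copies)
  also have "\<dots> = avg ?P (\<lambda>x. (F x - avg ?P F) * G x)"
    by (simp add: avg_cmult avg_diff avg_const[OF ne] mult.commute)
  finally show ?thesis by simp
qed

text \<open>With \<open>G = F\<close> each summand pairs a plain increment with a hybrid one.
  Swapping all coordinates below \<open>j\<close> carries one into the other, so their second
  moments agree and \<open>a * b <= (a^2 + b^2) / 2\<close> suffices.\<close>

lemma efron_stein:
  assumes fin: "finite V" "V \<noteq> {}"
  shows "var ({..<n} \<rightarrow>\<^sub>E V) F \<le>
    (\<Sum>j<n. avg ({..<n} \<rightarrow>\<^sub>E V \<times> V) (\<lambda>Z. (F (first_copy n Z) - F (first_copy n (swap_on {j} Z)))\<^sup>2)) / 2"
proof -
  let ?P = "{..<n} \<rightarrow>\<^sub>E V" and ?P2 = "{..<n} \<rightarrow>\<^sub>E V \<times> V"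
  let ?E = "\<lambda>j Z. F (first_copy n Z) - F (first_copy n (swap_on {j} Z))"
  let ?D = "\<lambda>j Z. F (hybrid n j Z) - F (hybrid n (Suc j) Z)"
  have ne: "finite ?P" "?P \<noteq> {}" using fin by (auto simp: finite_PiE PiE_eq_empty_iff)
  have "avg ?P2 (\<lambda>Z. ?E j Z * ?D j Z) \<le> avg ?P2 (\<lambda>Z. (?E j Z)\<^sup>2)" if j: "j < n" for j
  proof -
    have "avg ?P2 (\<lambda>Z. (?D j Z)\<^sup>2) = avg ?P2 (\<lambda>Z. (\<lambda>Z. (?E j Z)\<^sup>2) (swap_on {..<j} Z))"
      by (simp add: hybrid_def[symmetric] hybrid_Suc[symmetric])
    also have "\<dots> = avg ?P2 (\<lambda>Z. (?E j Z)\<^sup>2)"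
      by (rule avg_swap_on) (use j in auto)
    finally have eq: "avg ?P2 (\<lambda>Z. (?D j Z)\<^sup>2) = avg ?P2 (\<lambda>Z. (?E j Z)\<^sup>2)" .
    have "a * b \<le> (a\<^sup>2 + b\<^sup>2) / 2" for a b :: real
      using sum_squares_bound[of a b] by simp
    then have "avg ?P2 (\<lambda>Z. ?E j Z * ?D j Z) \<le> avg ?P2 (\<lambda>Z. ((?E j Z)\<^sup>2 + (?D j Z)\<^sup>2) * (1 / 2))"
      by (intro avg_mono) simp
    then show ?thesis unfolding avg_cmult_right avg_add eq by simp
  qed
  then show ?thesis
    unfolding var_eq[OF ne] covariance_interpolation[OF fin] by (intro divide_right_mono sum_mono) auto
qed

section \<open>Stein's equation for the normal distribution\<close>

abbreviation std_phi :: "real \<Rightarrow> real" where "std_phi \<equiv> std_normal_density"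

lemma DERIV_std_phi: "(std_phi has_real_derivative - x * std_phi x) (at x)"
proof -
  have "(std_phi has_real_derivative exp (- x\<^sup>2 / 2) * (- x) / sqrt (2 * pi)) (at x)"
    unfolding std_normal_density_def[abs_def]
    by (auto intro!: derivative_eq_intros simp: divide_simps)
  then show ?thesis by (simp add: std_normal_density_def field_simps)
qed

lemma continuous_on_std_phi: "continuous_on A std_phi"
  by (intro continuous_at_imp_continuous_on ballI DERIV_isCont[OF DERIV_std_phi])

lemma std_phi_pos: "0 < std_phi x"
  by (rule normal_density_pos) simp

lemma Phi_eq_cdf: "Phi x = cdf (density lborel std_phi) x"
  by (simp add: Phi_def cdf_def2)

lemma std_normal_real_distribution: "real_distribution (density lborel std_phi)"
  by (rule real_dist_normal_dist)

lemma Phi_nonneg: "0 \<le> Phi x" and Phi_le_1: "Phi x \<le> 1"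
  and Phi_mono: "x \<le> y \<Longrightarrow> Phi x \<le> Phi y"
proof -
  interpret real_distribution "density lborel std_phi" by (rule std_normal_real_distribution)
  show "0 \<le> Phi x" "Phi x \<le> 1" "x \<le> y \<Longrightarrow> Phi x \<le> Phi y"
    unfolding Phi_eq_cdf by (auto simp: cdf_nonneg cdf_bounded_prob cdf_nondecreasing)
qed

lemma Phi_at_top: "(Phi \<longlongrightarrow> 1) at_top" and Phi_at_bot: "(Phi \<longlongrightarrow> 0) at_bot"
proof -
  interpret real_distribution "density lborel std_phi" by (rule std_normal_real_distribution)
  show "(Phi \<longlongrightarrow> 1) at_top" "(Phi \<longlongrightarrow> 0) at_bot"
    unfolding Phi_eq_cdf[abs_def] by (rule cdf_lim_at_top_prob cdf_lim_at_bot)+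
qed

lemma DERIV_Phi: "(Phi has_real_derivative std_phi x) (at x)"
proof -
  interpret real_distribution "density lborel std_phi" by (rule std_normal_real_distribution)
  \<comment> \<open>Differentiation is local: the fundamental theorem of calculus is applied on a
    bounded window around \<open>x\<close>.\<close>
  let ?a = "x - 1" and ?b = "x + 1"
  have int: "std_phi integrable_on {?a..?b}"
    by (intro integrable_continuous_real continuous_on_std_phi)
  have diff: "Phi y = Phi ?a + integral {?a..y} std_phi" if "y \<in> {?a..?b}" for y
  proof (cases "?a < y")
    case True
    have "Phi y - Phi ?a = measure (density lborel std_phi) {?a<..y}"
      unfolding Phi_eq_cdf by (rule cdf_diff_eq) (use True in auto)
    also have "\<dots> = (\<integral>u. indicator {?a<..y} u * std_phi u \<partial>lborel)"
    proof -
      have "measure (density lborel std_phi) {?a<..y} =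
          (\<integral>u. indicator {?a<..y} u \<partial>density lborel std_phi)"
        by simp
      also have "\<dots> = (\<integral>u. std_phi u *\<^sub>R indicator {?a<..y} u \<partial>lborel)"
        by (rule integral_density) auto
      finally show ?thesis by (simp add: mult.commute)
    qed
    also have "\<dots> = integral {?a<..y} std_phi"
      by (subst set_borel_integral_eq_integral(2)[symmetric])
        (simp_all add: set_integrable_def set_lebesgue_integral_def
          integrable_mult_indicator[where 'b = real, simplified])
    also have "\<dots> = integral {?a..y} std_phi"
      by (rule integral_subset_negligible) (auto intro: negligible_subset[of "{?a}"])
    finally show ?thesis by simp
  next
    case False
    then show ?thesis using that by simp
  qed
  have "((\<lambda>y. integral {?a..y} std_phi) has_real_derivative std_phi x) (at x within {?a..?b})"
    by (rule integral_has_real_derivative) (auto intro!: continuous_on_std_phi)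
  then have "((\<lambda>y. integral {?a..y} std_phi) has_real_derivative std_phi x) (at x)"
    by (subst (asm) at_within_interior) auto
  then have "((\<lambda>y. Phi ?a + integral {?a..y} std_phi) has_real_derivative std_phi x) (at x)"
    by (auto intro!: derivative_eq_intros)
  then show ?thesis
    by (rule has_field_derivative_transform_within_open[where S = "{?a<..<?b}"])
      (simp, simp, rule diff[symmetric], simp)
qed

text \<open>\<open>Phi x + Phi (- x)\<close> has derivative 0, and its limit at infinity identifies
  the constant.\<close>

lemma Phi_minus: "Phi (- x) = 1 - Phi x"
proof -
  have "((\<lambda>x. Phi x + Phi (- x)) has_real_derivative 0) (at x)" for x
    by (auto intro!: derivative_eq_intros DERIV_Phi DERIV_chain2[of Phi] simp: std_normal_density_def)
  then obtain c where c: "Phi y + Phi (- y) = c" for y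
    using DERIV_isconst_all[of "\<lambda>x. Phi x + Phi (- x)"] by blast
  have "((\<lambda>y. Phi y + Phi (- y)) \<longlongrightarrow> 1 + 0) at_top"
    by (intro tendsto_add Phi_at_top filterlim_compose[OF Phi_at_bot] filterlim_uminus_at_bot_at_top)
  then have "c = 1"
    by (simp add: c tendsto_const_iff)
  with c[of x] have "Phi x + Phi (- x) = 1" by simp
  then show ?thesis by simp
qed

section \<open>Mills' ratio and its bounds\<close>

definition mills :: "real \<Rightarrow> real" where
  "mills x = (1 - Phi x) / std_phi x"

text \<open>This linear equation is why constant multiples of \<open>mills w\<close> and
  \<open>mills (- w)\<close> solve Stein's equation on the two sides of the threshold.\<close>

lemma DERIV_mills: "(mills has_real_derivative x * mills x - 1) (at x)"
  unfolding mills_def[abs_def]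
  by (rule derivative_eq_intros DERIV_Phi DERIV_std_phi refl)+
    (use std_phi_pos[of x] in \<open>auto simp: field_simps power2_eq_square\<close>)

lemma mills_nonneg: "0 \<le> mills x"
  using std_phi_pos[of x] Phi_le_1[of x] by (simp add: mills_def)

lemma std_phi_at_top: "(std_phi \<longlongrightarrow> 0) at_top"
  unfolding std_normal_density_def[abs_def] by real_asymp

lemma nonneg_of_deriv_nonpos_limit_0:
  fixes h :: "real \<Rightarrow> real"
  assumes "\<And>y. x \<le> y \<Longrightarrow> (h has_real_derivative h' y) (at y)" "\<And>y. x \<le> y \<Longrightarrow> h' y \<le> 0"
    and lim: "(h \<longlongrightarrow> 0) at_top"
  shows "0 \<le> h x"
proof -
  have "h y \<le> h x" if "x \<le> y" for y
    by (rule DERIV_nonpos_imp_nonincreasing[OF that]) (use assms in blast)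
  then show ?thesis
    by (intro tendsto_upperbound[OF lim]) (auto simp: eventually_at_top_linorder)
qed

text \<open>Exactly what makes the derivative of \<open>x * mills x\<close> nonnegative. After
  multiplication by the density, the difference of the two sides decreases on the whole line and
  tends to 0.\<close>

lemma mills_lower: "x / (1 + x\<^sup>2) \<le> mills x"
proof -
  define h where "h = (\<lambda>x. 1 - Phi x - x / (1 + x\<^sup>2) * std_phi x)"
  have nz: "1 + y\<^sup>2 \<noteq> 0" for y :: real
    by (smt (verit) zero_le_power2)
  have "0 \<le> h x"
  proof (rule nonneg_of_deriv_nonpos_limit_0[where h = h and x = x and h' = "\<lambda>y. - 2 * std_phi y / (1 + y\<^sup>2)\<^sup>2"])
    fix y :: real assume "x \<le> y"
    show "(h has_real_derivative - 2 * std_phi y / (1 + y\<^sup>2)\<^sup>2) (at y)"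
      unfolding h_def
      by (rule derivative_eq_intros DERIV_Phi DERIV_std_phi refl nz)+
        (use nz[of y] in \<open>simp add: divide_simps, simp add: power2_eq_square algebra_simps\<close>)
  next
    fix y :: real
    show "- 2 * std_phi y / (1 + y\<^sup>2)\<^sup>2 \<le> 0"
      using std_phi_pos[of y] by simp
  next
    have "((\<lambda>x::real. x / (1 + x\<^sup>2)) \<longlongrightarrow> 0) at_top" by real_asymp
    then have "(h \<longlongrightarrow> 1 - 1 - 0 * 0) at_top"
      unfolding h_def by (intro tendsto_intros Phi_at_top std_phi_at_top)
    then show "(h \<longlongrightarrow> 0) at_top" by simp
  qed
  then show ?thesis
    using std_phi_pos[of x] by (simp add: h_def mills_def pos_le_divide_eq)
qed

lemma mills_upper: "x * mills x \<le> 1"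
proof -
  define h where "h = (\<lambda>x. std_phi x - x * (1 - Phi x))"
  have "0 \<le> h x" if "0 < x"
  proof -
    \<comment> \<open>Dividing by \<open>x\<close> makes the limit at infinity immediate;
      \<open>x * (1 - Phi x)\<close> would need a tail estimate of its own.\<close>
    define g where "g = (\<lambda>x. std_phi x / x - (1 - Phi x))"
    have "0 \<le> g x"
    proof (rule nonneg_of_deriv_nonpos_limit_0[where h = g and x = x and h' = "\<lambda>y. - std_phi y / y\<^sup>2"])
      fix y :: real assume "x \<le> y"
      then have "y > 0" using that by simp
      then show "(g has_real_derivative - std_phi y / y\<^sup>2) (at y)"
        unfolding g_def
        by - (rule derivative_eq_intros DERIV_Phi DERIV_std_phi refl |
            simp add: power2_eq_square add_divide_distrib diff_divide_distrib)+
    next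
      fix y :: real
      show "- std_phi y / y\<^sup>2 \<le> 0"
        using std_phi_pos[of y] by simp
    next
      have "((\<lambda>x::real. std_phi x / x) \<longlongrightarrow> 0) at_top"
        unfolding std_normal_density_def by real_asymp
      then have "(g \<longlongrightarrow> 0 - (1 - 1)) at_top"
        unfolding g_def by (intro tendsto_intros Phi_at_top)
      then show "(g \<longlongrightarrow> 0) at_top" by simp
    qed
    then show ?thesis using that by (simp add: g_def h_def field_simps)
  qed
  moreover have "0 \<le> h x" if "x \<le> 0"
    using that std_phi_pos[of x] Phi_le_1[of x] mult_nonpos_nonneg[of x "1 - Phi x"]
    by (simp add: h_def)
  ultimately have "0 \<le> h x" by linarith
  then show ?thesis
    using std_phi_pos[of x] by (simp add: h_def mills_def pos_divide_le_eq)
qed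

text \<open>Gives the monotonicity of \<open>w * f w\<close> for the Stein solution \<open>f\<close>
  on each side of the threshold.\<close>

lemma mono_times_mills: "x \<le> y \<Longrightarrow> x * mills x \<le> y * mills y"
proof (rule DERIV_nonneg_imp_nondecreasing[where f = "\<lambda>x. x * mills x"])
  fix u :: real
  have "((\<lambda>x. x * mills x) has_real_derivative (1 + u\<^sup>2) * mills u - u) (at u)"
    by (rule derivative_eq_intros DERIV_mills refl)+ (simp add: power2_eq_square algebra_simps)
  moreover have "0 < 1 + u\<^sup>2" by (smt (verit) zero_le_power2)
  then have "0 \<le> (1 + u\<^sup>2) * mills u - u"
    using mills_lower[of u] by (simp add: field_simps)
  ultimately show "\<exists>D. ((\<lambda>x. x * mills x) has_real_derivative D) (at u) \<and> 0 \<le> D" by blast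
qed

lemma mills_minus: "mills (- x) = Phi x / std_phi x"
  by (simp add: mills_def Phi_minus std_normal_density_def)

lemma DERIV_mills_minus:
  "((\<lambda>x. mills (- x)) has_real_derivative 1 + x * mills (- x)) (at x)"
proof -
  have "((\<lambda>x. mills (- x)) has_real_derivative (- x * mills (- x) - 1) * - 1) (at x)"
    by (rule DERIV_chain2[OF DERIV_mills]) (auto intro!: derivative_eq_intros)
  then show ?thesis by simp
qed

text \<open>\<open>f\<close> solves the Stein equation \<open>f' w - w * f w = of_bool (w \<le> z) - Phi z\<close> and \<open>k\<close> is its
  derivative. Both parts of \<open>k\<close> are monotone, in opposite directions; \<open>q\<close> is their difference.\<close>
lemma stein_solution:
  obtains f k q :: "real \<Rightarrow> real"
  where "\<And>w. k w - w * f w = of_bool (w \<le> z) - Phi z" "\<And>w. \<bar>k w\<bar> \<le> 2" "\<And>w. \<bar>q w\<bar> \<le> 2"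
    "\<And>w w'. \<bar>f w - f w' - (w - w') * k w\<bar> \<le> (w - w') * (q w - q w')"
proof -
  define f1 where "f1 = (\<lambda>w. (1 - Phi z) * mills (- w))"
  define f2 where "f2 = (\<lambda>w. Phi z * mills w)"
  define f where "f = (\<lambda>w. if w \<le> z then f1 w else f2 w)"
  define g where "g = (\<lambda>w. w * f w)"
  define k where "k = (\<lambda>w. g w + of_bool (w \<le> z) - Phi z)"
  define q where "q = (\<lambda>w. g w - of_bool (w \<le> z))"
  \<comment> \<open>The branches meet, so \<open>f\<close> is continuous at \<open>z\<close>; only
    its derivative jumps there.\<close>
  have z: "f1 z = f2 z"
    by (simp add: f1_def f2_def mills_def Phi_minus std_normal_density_def)
  have g_le: "g u \<le> g v" if "u \<le> v" for u v
  proof -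
    have 1: "u * f1 u \<le> v * f1 v" if "u \<le> v" for u v
      using mult_left_mono[OF mono_times_mills[of "- v" "- u"], of "1 - Phi z"] that Phi_le_1[of z]
      by (simp add: f1_def algebra_simps)
    have 2: "u * f2 u \<le> v * f2 v" if "u \<le> v" for u v
      using mult_left_mono[OF mono_times_mills[of u v], of "Phi z"] that Phi_nonneg[of z]
      by (simp add: f2_def algebra_simps)
    show ?thesis
      using 1[of u v] 2[of u v] 1[of u z] 2[of z v] z that by (auto simp: g_def f_def)
  qed
  have g_bound: "\<bar>g w\<bar> \<le> 1" for w
  proof -
    \<comment> \<open>Covers both branches: \<open>u\<close> is the argument of \<open>mills\<close>
      and \<open>p\<close> the constant factor. The condition \<open>p <= 1 - Phi (- u)\<close>
      encodes the position of \<open>w\<close> relative to \<open>z\<close>; for negative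
      \<open>u\<close> it bounds \<open>p * mills u\<close> by \<open>mills (- u)\<close>, to which
      \<open>mills_upper\<close> applies.\<close>
    have key: "\<bar>w * (p * mills u)\<bar> \<le> 1" if "\<bar>w\<bar> = \<bar>u\<bar>" "0 \<le> p" "p \<le> 1" "p \<le> 1 - Phi (- u)" for w u p
    proof (cases "0 \<le> u")
      case True
      have "p * (u * mills u) \<le> 1 * 1"
        by (intro mult_mono mills_upper) (use True that mills_nonneg[of u] in auto)
      then show ?thesis using that True mills_nonneg[of u]
        by (simp add: abs_mult algebra_simps)
    next
      case False
      have "p * mills u \<le> (1 - Phi (- u)) * mills u"
        by (intro mult_right_mono that mills_nonneg)
      also have "\<dots> \<le> mills (- u)"
        using std_phi_pos[of u] Phi_nonneg[of u] Phi_le_1[of u]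
        by (simp add: mills_minus Phi_minus) (simp add: mills_def divide_right_mono mult_left_le)
      finally have "- u * (p * mills u) \<le> - u * mills (- u)"
        by (intro mult_left_mono) (use False in auto)
      then have "- u * (p * mills u) \<le> 1" using mills_upper[of "- u"] by linarith
      then show ?thesis using that False mills_nonneg[of u]
        by (simp add: abs_mult)
    qed
    show ?thesis
      using key[of w "- w" "1 - Phi z"] key[of w w "Phi z"] Phi_nonneg[of z] Phi_le_1[of z]
        Phi_mono[of w z] Phi_mono[of z w]
      by (auto simp: g_def f_def f1_def f2_def Phi_minus)
  qed
  have k_bound: "\<bar>k w\<bar> \<le> 2" for w
    using g_bound[of w] Phi_nonneg[of z] Phi_le_1[of z] by (auto simp: k_def)
  have q_bound: "\<bar>q w\<bar> \<le> 2" for w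
    using g_bound[of w] by (auto simp: q_def)
  \<comment> \<open>The two monotone parts of \<open>k\<close> move in opposite directions, so the
    sum of their absolute changes is the change of \<open>q\<close>.\<close>
  have k_q: "\<bar>k x - k y\<bar> \<le> q y - q x" if "x \<le> y" for x y
    using g_le[OF that] that by (auto simp: k_def q_def)
  have q_le: "q x \<le> q y" if "x \<le> y" for x y
    using k_q[OF that] by linarith
  have low: "\<exists>\<xi>. a < \<xi> \<and> \<xi> < b \<and> f b - f a = (b - a) * k \<xi>" if "a < b" "b \<le> z" for a b
  proof -
    have "(f1 has_real_derivative (1 - Phi z) * (1 + x * mills (- x))) (at x)" for x
      unfolding f1_def by (intro DERIV_cmult DERIV_mills_minus)
    from MVT2[OF that(1) this] obtain \<xi> where \<xi>: "a < \<xi>" "\<xi> < b"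
      "f1 b - f1 a = (b - a) * ((1 - Phi z) * (1 + \<xi> * mills (- \<xi>)))" by blast
    moreover have "(1 - Phi z) * (1 + \<xi> * mills (- \<xi>)) = k \<xi>"
      using \<xi> that by (simp add: k_def g_def f_def f1_def algebra_simps)
    ultimately show ?thesis using that by (intro exI[of _ \<xi>]) (auto simp: f_def)
  qed
  have high: "\<exists>\<xi>. a < \<xi> \<and> \<xi> < b \<and> f b - f a = (b - a) * k \<xi>" if "a < b" "z \<le> a" for a b
  proof -
    have "(f2 has_real_derivative Phi z * (x * mills x - 1)) (at x)" for x
      unfolding f2_def by (intro DERIV_cmult DERIV_mills)
    from MVT2[OF that(1) this] obtain \<xi> where \<xi>: "a < \<xi>" "\<xi> < b"
      "f2 b - f2 a = (b - a) * (Phi z * (\<xi> * mills \<xi> - 1))" by blast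
    moreover have "Phi z * (\<xi> * mills \<xi> - 1) = k \<xi>"
      using \<xi> that by (simp add: k_def g_def f_def f2_def algebra_simps)
    moreover have "f a = f2 a" "f b = f2 b" using z that by (auto simp: f_def)
    ultimately show ?thesis by (intro exI[of _ \<xi>]) auto
  qed
  have incr: "\<bar>f b - f a - (b - a) * c\<bar> \<le> (b - a) * B"
    if "a < b" and B: "\<And>x. a < x \<Longrightarrow> x < b \<Longrightarrow> \<bar>k x - c\<bar> \<le> B" for a b c B
  proof -
    have piece: "\<bar>f b' - f a' - (b' - a') * c\<bar> \<le> (b' - a') * B"
      if ab: "a' < b'" "a \<le> a'" "b' \<le> b" "b' \<le> z \<or> z \<le> a'" for a' b'
    proof -
      obtain \<xi> where \<xi>: "a' < \<xi>" "\<xi> < b'" "f b' - f a' = (b' - a') * k \<xi>"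
        using low[OF ab(1)] high[OF ab(1)] ab(4) by blast
      then have "\<bar>f b' - f a' - (b' - a') * c\<bar> = (b' - a') * \<bar>k \<xi> - c\<bar>"
        using that by (simp add: abs_mult right_diff_distrib[symmetric])
      also have "\<dots> \<le> (b' - a') * B"
        using \<xi> that by (intro mult_left_mono B) auto
      finally show ?thesis .
    qed
    show ?thesis
    proof (cases "b \<le> z \<or> z \<le> a")
      case True
      then show ?thesis using piece[of a b] that(1) by simp
    next
      \<comment> \<open>The interval straddles the kink at \<open>z\<close>: the mean value theorem
        is used on both halves and the estimates add up.\<close>
      case False
      then have "\<bar>f z - f a - (z - a) * c\<bar> \<le> (z - a) * B" "\<bar>f b - f z - (b - z) * c\<bar> \<le> (b - z) * B"
        by (intro piece; force)+
      then show ?thesis by (simp add: algebra_simps abs_le_iff)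
    qed
  qed
  have "\<bar>f w - f w' - (w - w') * k w\<bar> \<le> (w - w') * (q w - q w')" for w w'
  proof (rule linorder_cases[of w w'])
    assume less: "w < w'"
    have "\<bar>f w' - f w - (w' - w) * k w\<bar> \<le> (w' - w) * (q w' - q w)"
    proof (rule incr[OF less])
      fix x assume "w < x" "x < w'"
      then show "\<bar>k x - k w\<bar> \<le> q w' - q w"
        using k_q[of w x] q_le[of x w'] by linarith
    qed
    then show ?thesis by (simp add: abs_le_iff algebra_simps)
  next
    assume less: "w' < w"
    show ?thesis
    proof (rule incr[OF less])
      fix x assume "w' < x" "x < w"
      then show "\<bar>k x - k w\<bar> \<le> q w - q w'"
        using k_q[of x w] q_le[of w' x] by linarith
    qed
  qed simp
  moreover have "k w - w * f w = of_bool (w \<le> z) - Phi z" for w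
    by (simp add: k_def g_def)
  ultimately show ?thesis
    using that k_bound q_bound by blast
qed

section \<open>A normal approximation bound for functions of independent variables\<close>

lemma avg_first_copy:
  assumes "finite V" "V \<noteq> {}"
  shows "avg ({..<n} \<rightarrow>\<^sub>E V \<times> V) (\<lambda>Z. f (first_copy n Z)) = avg ({..<n} \<rightarrow>\<^sub>E V) f"
  using avg_copies[of n V "\<lambda>x y. f x"] assms
  by (simp add: avg_const finite_PiE PiE_eq_empty_iff)

locale stein_pairs =
  fixes V :: "'v set" and n :: nat and F :: "(nat \<Rightarrow> 'v) \<Rightarrow> real"
  assumes fin_V: "finite V" "V \<noteq> {}"
begin

abbreviation "P \<equiv> {..<n} \<rightarrow>\<^sub>E V"
abbreviation "P2 \<equiv> {..<n} \<rightarrow>\<^sub>E V \<times> V"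

definition D :: "nat \<Rightarrow> (nat \<Rightarrow> 'v \<times> 'v) \<Rightarrow> real" where
  "D j Z = F (first_copy n Z) - F (first_copy n (swap_on {j} Z))"

definition D' :: "nat \<Rightarrow> (nat \<Rightarrow> 'v \<times> 'v) \<Rightarrow> real" where
  "D' j Z = F (hybrid n j Z) - F (hybrid n (Suc j) Z)"

text \<open>Normalised to have the variance of \<open>F\<close> as its average, so that only its
  fluctuation enters the error.\<close>

definition T :: "(nat \<Rightarrow> 'v \<times> 'v) \<Rightarrow> real" where
  "T Z = (\<Sum>j<n. D j Z * D' j Z) / 2"

text \<open>Only \<open>D'\<close> carries the absolute value: each summand stays odd under the swap
  of its coordinate, so the average is 0.\<close>

definition T_abs :: "(nat \<Rightarrow> 'v \<times> 'v) \<Rightarrow> real" where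
  "T_abs Z = (\<Sum>j<n. \<bar>D' j Z\<bar> * D j Z)"

lemma fin_P: "finite P" "P \<noteq> {}" and fin_P2: "finite P2" "P2 \<noteq> {}"
  using fin_V by (auto simp: finite_PiE PiE_eq_empty_iff)

lemma D_swap: "D j (swap_on {j} Z) = - D j Z"
  by (simp add: D_def swap_on_swap_on)

lemma D'_swap: "D' j (swap_on {j} Z) = - D' j Z"
  by (simp add: D'_def hybrid_swap hybrid_Suc_swap)

lemma covariance_D:
  "avg P (\<lambda>x. (F x - avg P F) * G x) =
    (\<Sum>j<n. avg P2 (\<lambda>Z. (G (first_copy n Z) - G (first_copy n (swap_on {j} Z))) * D' j Z)) / 2"
  unfolding D'_def by (rule covariance_interpolation[OF fin_V])

lemma avg_T: "avg P2 T = var P F"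
  unfolding var_eq[OF fin_P] covariance_D D_def[symmetric] T_def[abs_def]
  using avg_cmult_right[of P2 "\<lambda>Z. \<Sum>j<n. D j Z * D' j Z" "1 / 2"] by (simp add: avg_sum)

text \<open>Oddness under the swap of coordinate \<open>j\<close> turns the weight into half its
  increment. Read from right to left, a sum over increments of \<open>h\<close> collapses to
  \<open>T_abs\<close> times \<open>h\<close>; this absorbs the Taylor remainder.\<close>

lemma avg_T_abs_weighted:
  "avg P2 (\<lambda>Z. T_abs Z * h (first_copy n Z)) =
    (\<Sum>j<n. avg P2 (\<lambda>Z. \<bar>D' j Z\<bar> * D j Z * (h (first_copy n Z) - h (first_copy n (swap_on {j} Z))))) / 2"
proof -
  have "avg P2 (\<lambda>Z. \<bar>D' j Z\<bar> * D j Z * (h (first_copy n Z) - h (first_copy n (swap_on {j} Z))))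
      = 2 * avg P2 (\<lambda>Z. \<bar>D' j Z\<bar> * D j Z * h (first_copy n Z))" if "j < n" for j
  proof -
    have "avg P2 (\<lambda>Z. \<bar>D' j Z\<bar> * D j Z * h (first_copy n (swap_on {j} Z)))
        = avg P2 (\<lambda>Z. (\<lambda>Z. - (\<bar>D' j Z\<bar> * D j Z * h (first_copy n Z))) (swap_on {j} Z))"
      by (simp add: D_swap D'_swap)
    also have "\<dots> = - avg P2 (\<lambda>Z. \<bar>D' j Z\<bar> * D j Z * h (first_copy n Z))"
      by (subst avg_swap_on) (use that in \<open>auto simp: avg_uminus\<close>)
    finally show ?thesis by (simp add: right_diff_distrib avg_diff)
  qed
  then show ?thesis
    unfolding T_abs_def sum_distrib_right avg_sum by (simp add: sum_distrib_left[symmetric])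
qed

lemma avg_T_abs: "avg P2 T_abs = 0"
  using avg_T_abs_weighted[of "\<lambda>_. 1"] by (simp add: avg_def)

text \<open>Stein's equation leaves \<open>v - T\<close> tested against \<open>k\<close>, and a
  remainder \<open>T_abs\<close> tested against \<open>q\<close>. Both \<open>v - T\<close> and
  \<open>T_abs\<close> are centred, and \<open>k\<close> and \<open>q\<close> are bounded by 2, the
  constant in front.\<close>

theorem kolmogorov_bound:
  assumes pos: "0 < var P F"
  shows "\<bar>avg P (\<lambda>x. of_bool ((F x - avg P F) / sqrt (var P F) \<le> z)) - Phi z\<bar>
    \<le> 2 / var P F * (sqrt (var P2 T) + sqrt (var P2 T_abs))"
proof -
  define v where "v = var P F"
  define s where "s = sqrt v"
  define W where "W = (\<lambda>x. (F x - avg P F) / s)"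
  have v: "0 < v" "0 < s" "s * s = v"
    using pos by (auto simp: s_def v_def)
  obtain f k q :: "real \<Rightarrow> real" where
    stein: "\<And>w. k w - w * f w = of_bool (w \<le> z) - Phi z" and
    k: "\<And>w. \<bar>k w\<bar> \<le> 2" and q: "\<And>w. \<bar>q w\<bar> \<le> 2" and
    taylor: "\<And>w w'. \<bar>f w - f w' - (w - w') * k w\<bar> \<le> (w - w') * (q w - q w')"
    using stein_solution[of z] by metis
  let ?X = "first_copy n" and ?Xj = "\<lambda>j Z. first_copy n (swap_on {j} Z)"
  have W_diff: "W (?X Z) - W (?Xj j Z) = D j Z / s" for j Z
    by (simp add: W_def D_def diff_divide_distrib)
  have 1: "avg P (\<lambda>x. W x * f (W x)) =
      (\<Sum>j<n. avg P2 (\<lambda>Z. (f (W (?X Z)) - f (W (?Xj j Z))) * D' j Z)) / (2 * s)"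
  proof -
    have "avg P (\<lambda>x. W x * f (W x)) = avg P (\<lambda>x. (F x - avg P F) * f (W x)) * (1 / s)"
      unfolding avg_cmult_right[symmetric] by (rule avg_cong) (simp add: W_def)
    also have "\<dots> = (\<Sum>j<n. avg P2 (\<lambda>Z. (f (W (?X Z)) - f (W (?Xj j Z))) * D' j Z)) / (2 * s)"
      unfolding covariance_D by simp
    finally show ?thesis .
  qed
  have 2: "avg P2 (\<lambda>Z. k (W (?X Z)) * T Z) / v =
      (\<Sum>j<n. avg P2 (\<lambda>Z. D j Z / s * k (W (?X Z)) * D' j Z)) / (2 * s)"
  proof -
    have "k (W (?X Z)) * T Z = (\<Sum>j<n. D j Z / s * k (W (?X Z)) * D' j Z) * (s / 2)" for Z
      using v by (simp add: T_def sum_distrib_left sum_distrib_right sum_divide_distrib mult_ac)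
    then have "avg P2 (\<lambda>Z. k (W (?X Z)) * T Z) =
        (\<Sum>j<n. avg P2 (\<lambda>Z. D j Z / s * k (W (?X Z)) * D' j Z)) * (s / 2)"
      by (simp only: avg_cmult_right avg_sum)
    moreover have "S * (s / 2) / v = S / (2 * s)" for S
      using v(2) unfolding v(3)[symmetric] by simp
    ultimately show ?thesis by (simp only:)
  qed
  have 3: "\<bar>avg P2 (\<lambda>Z. (f (W (?X Z)) - f (W (?Xj j Z))) * D' j Z) - avg P2 (\<lambda>Z. D j Z / s * k (W (?X Z)) * D' j Z)\<bar>
     \<le> avg P2 (\<lambda>Z. \<bar>D' j Z\<bar> * D j Z * (q (W (?X Z)) - q (W (?Xj j Z)))) / s" for j
  proof -
    have "\<bar>(f (W (?X Z)) - f (W (?Xj j Z))) * D' j Z - D j Z / s * k (W (?X Z)) * D' j Z\<bar>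
       \<le> \<bar>D' j Z\<bar> * D j Z * (q (W (?X Z)) - q (W (?Xj j Z))) * (1 / s)" for Z
    proof -
      have "\<bar>(f (W (?X Z)) - f (W (?Xj j Z))) * D' j Z - D j Z / s * k (W (?X Z)) * D' j Z\<bar>
          = \<bar>D' j Z\<bar> * \<bar>f (W (?X Z)) - f (W (?Xj j Z)) - (W (?X Z) - W (?Xj j Z)) * k (W (?X Z))\<bar>"
        unfolding W_diff abs_mult[symmetric] by (simp add: algebra_simps)
      also have "\<dots> \<le> \<bar>D' j Z\<bar> * ((W (?X Z) - W (?Xj j Z)) * (q (W (?X Z)) - q (W (?Xj j Z))))"
        by (intro mult_left_mono taylor) simp
      finally show ?thesis unfolding W_diff by simp
    qed
    then have "avg P2 (\<lambda>Z. \<bar>(f (W (?X Z)) - f (W (?Xj j Z))) * D' j Z - D j Z / s * k (W (?X Z)) * D' j Z\<bar>)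
        \<le> avg P2 (\<lambda>Z. \<bar>D' j Z\<bar> * D j Z * (q (W (?X Z)) - q (W (?Xj j Z))) * (1 / s))"
      by (intro avg_mono)
    then show ?thesis
      using abs_avg_le[of P2 "\<lambda>Z. (f (W (?X Z)) - f (W (?Xj j Z))) * D' j Z - D j Z / s * k (W (?X Z)) * D' j Z"]
      unfolding avg_diff avg_cmult_right by simp
  qed
  have "\<bar>avg P (\<lambda>x. W x * f (W x)) - avg P2 (\<lambda>Z. k (W (?X Z)) * T Z) / v\<bar>
      \<le> (\<Sum>j<n. avg P2 (\<lambda>Z. \<bar>D' j Z\<bar> * D j Z * (q (W (?X Z)) - q (W (?Xj j Z)))) / s) / (2 * s)"
    unfolding 1 2 diff_divide_distrib[symmetric] sum_subtractf[symmetric] abs_divide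
    using v by (intro frac_le order.trans[OF sum_abs] sum_mono 3 sum_nonneg)
      (auto intro: order.trans[OF _ 3] )
  \<comment> \<open>Antisymmetry undoes the increment of \<open>q\<close>, so no bound on the size
    of the jumps is needed.\<close>
  also have "\<dots> = avg P2 (\<lambda>Z. T_abs Z * q (W (?X Z))) / v"
    unfolding avg_T_abs_weighted[of "\<lambda>x. q (W x)"]
    using v by (simp add: sum_divide_distrib[symmetric] mult.assoc)
  also have "\<dots> \<le> avg P2 (\<lambda>Z. \<bar>T_abs Z\<bar> * 2) / v"
  proof (intro divide_right_mono avg_mono)
    fix Z
    have "T_abs Z * q (W (?X Z)) \<le> \<bar>T_abs Z\<bar> * \<bar>q (W (?X Z))\<bar>"
      by (metis abs_ge_self abs_mult)
    also have "\<dots> \<le> \<bar>T_abs Z\<bar> * 2" by (intro mult_left_mono q) simp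
    finally show "T_abs Z * q (W (?X Z)) \<le> \<bar>T_abs Z\<bar> * 2" .
  qed (use v in simp)
  also have "\<dots> \<le> sqrt (var P2 T_abs) * 2 / v"
    unfolding avg_cmult_right using avg_abs_dev_le[OF fin_P2, of T_abs] v
    by (intro divide_right_mono) (auto simp: avg_T_abs)
  finally have rem: "\<bar>avg P (\<lambda>x. W x * f (W x)) - avg P2 (\<lambda>Z. k (W (?X Z)) * T Z) / v\<bar>
      \<le> sqrt (var P2 T_abs) * 2 / v" .
  have "avg P2 (\<lambda>Z. k (W (?X Z)) * (v - T Z)) =
      avg P (\<lambda>x. k (W x)) * v - avg P2 (\<lambda>Z. k (W (?X Z)) * T Z)"
    by (simp only: right_diff_distrib avg_diff avg_cmult_right avg_first_copy[OF fin_V, of n "\<lambda>x. k (W x)"])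
  then have "avg P (\<lambda>x. k (W x)) - avg P2 (\<lambda>Z. k (W (?X Z)) * T Z) / v =
      avg P2 (\<lambda>Z. k (W (?X Z)) * (v - T Z)) / v"
    using v(1) by (simp add: diff_divide_distrib)
  then have "\<bar>avg P (\<lambda>x. k (W x)) - avg P2 (\<lambda>Z. k (W (?X Z)) * T Z) / v\<bar>
      = \<bar>avg P2 (\<lambda>Z. k (W (?X Z)) * (v - T Z))\<bar> / v"
    using v(1) by (simp only: abs_divide abs_of_pos)
  also have "\<dots> \<le> avg P2 (\<lambda>Z. 2 * \<bar>T Z - v\<bar>) / v"
  proof (intro divide_right_mono order.trans[OF abs_avg_le] avg_mono)
    fix Z show "\<bar>k (W (?X Z)) * (v - T Z)\<bar> \<le> 2 * \<bar>T Z - v\<bar>"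
      unfolding abs_mult abs_minus_commute[of v] by (intro mult_right_mono k) simp
  qed (use v in simp)
  also have "\<dots> \<le> 2 * sqrt (var P2 T) / v"
    unfolding avg_cmult using avg_abs_dev_le[OF fin_P2, of T] v
    by (intro divide_right_mono) (auto simp: avg_T v_def)
  finally have main: "\<bar>avg P (\<lambda>x. k (W x)) - avg P2 (\<lambda>Z. k (W (?X Z)) * T Z) / v\<bar>
      \<le> 2 * sqrt (var P2 T) / v" .
  have "avg P (\<lambda>x. of_bool (W x \<le> z)) - Phi z = avg P (\<lambda>x. k (W x)) - avg P (\<lambda>x. W x * f (W x))"
    unfolding avg_diff[symmetric] stein by (simp add: avg_diff avg_const[OF fin_P])
  then have "\<bar>avg P (\<lambda>x. of_bool (W x \<le> z)) - Phi z\<bar> \<le> 2 * sqrt (var P2 T) / v + sqrt (var P2 T_abs) * 2 / v"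
    using main rem by linarith
  also have "\<dots> = 2 / v * (sqrt (var P2 T) + sqrt (var P2 T_abs))"
    by (simp add: distrib_left mult.commute)
  finally show ?thesis by (simp add: W_def s_def v_def)
qed

end

section \<open>Occupancy counts and their moments\<close>

definition cnt :: "nat \<Rightarrow> (nat \<Rightarrow> 'v) \<Rightarrow> 'v \<Rightarrow> nat" where
  "cnt n x u = card {i \<in> {..<n}. x i = u}"

lemma cnt_eq_sum: "real (cnt n x u) = (\<Sum>i<n. of_bool (x i = u))"
  by (simp add: cnt_def Int_def)

lemma sum_cnt:
  fixes m :: nat
  assumes "x \<in> {..<n} \<rightarrow>\<^sub>E {..<m}"
  shows "(\<Sum>u<m. real (cnt n x u)) = real n"
proof -
  have "(\<Sum>u<m. of_bool (x i = u)) = (1 :: real)" if "i < n" for i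
  proof -
    have "x i < m" using assms that by auto
    moreover have "(\<Sum>u<m. of_bool (x i = u)) = (\<Sum>u<m. if u = x i then 1 else (0 :: real))"
      by (rule sum.cong) auto
    ultimately show ?thesis by simp
  qed
  then show ?thesis
    unfolding cnt_eq_sum by (subst sum.swap) simp
qed

text \<open>The binomial probability with parameters \<open>n\<close> and \<open>1/m\<close>, over
  the common denominator \<open>m ^ n\<close> so that neighbouring values compare by their
  numerators; it is 0 for \<open>r > n\<close>.\<close>

definition binp :: "nat \<Rightarrow> nat \<Rightarrow> nat \<Rightarrow> real" where
  "binp n m r = real (n choose r) * (real m - 1) ^ (n - r) / real m ^ n"

lemma occ_nonempty: "0 < m \<Longrightarrow> finite ({..<n::nat} \<rightarrow>\<^sub>E {..<m::nat}) \<and> {..<n} \<rightarrow>\<^sub>E {..<m} \<noteq> {}"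
  by (auto simp: PiE_eq_empty_iff intro!: finite_PiE)

lemma card_cnt_eq:
  fixes m :: nat
  assumes "v < m"
  shows "card {x \<in> {..<n} \<rightarrow>\<^sub>E {..<m}. cnt n x v = r} = (n choose r) * (m - 1) ^ (n - r)"
proof -
  let ?B = "\<lambda>A. PiE {..<n} (\<lambda>i. if i \<in> A then {v} else {..<m} - {v})"
  let ?As = "{A. A \<subseteq> {..<n} \<and> card A = r}"
  have A_eq: "{i \<in> {..<n}. x i = v} = A" if "x \<in> ?B A" "A \<subseteq> {..<n}" for x A
    using that by (auto simp: PiE_iff split: if_splits)
  have "{x \<in> {..<n} \<rightarrow>\<^sub>E {..<m}. cnt n x v = r} = (\<Union>A\<in>?As. ?B A)"
  proof (intro equalityI subsetI)
    fix x assume "x \<in> {x \<in> {..<n} \<rightarrow>\<^sub>E {..<m}. cnt n x v = r}"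
    then show "x \<in> (\<Union>A\<in>?As. ?B A)"
      by (intro UN_I[of "{i \<in> {..<n}. x i = v}"]) (auto simp: cnt_def PiE_iff)
  next
    fix x assume "x \<in> (\<Union>A\<in>?As. ?B A)"
    then obtain A where A: "A \<subseteq> {..<n}" "card A = r" "x \<in> ?B A" by auto
    then have "cnt n x v = r" using A_eq[OF A(3,1)] by (simp add: cnt_def)
    moreover have "x \<in> {..<n} \<rightarrow>\<^sub>E {..<m}"
      using A(3) assms by (auto simp: PiE_iff split: if_splits)
    ultimately show "x \<in> {x \<in> {..<n} \<rightarrow>\<^sub>E {..<m}. cnt n x v = r}" by simp
  qed
  moreover have "card (\<Union>A\<in>?As. ?B A) = (\<Sum>A\<in>?As. card (?B A))"
  proof (rule card_UN_disjoint)
    show "\<forall>A\<in>?As. finite (?B A)" by (auto intro!: finite_PiE)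
    show "\<forall>A\<in>?As. \<forall>A'\<in>?As. A \<noteq> A' \<longrightarrow> ?B A \<inter> ?B A' = {}"
      using A_eq by (metis (no_types, lifting) disjoint_iff mem_Collect_eq)
  qed simp
  moreover have "card (?B A) = (m - 1) ^ (n - r)" if "A \<in> ?As" for A
  proof -
    have "card (?B A) = (\<Prod>i<n. card (if i \<in> A then {v} else {..<m} - {v}))"
      by (simp add: card_PiE)
    also have "\<dots> = (\<Prod>i<n. if i \<in> A then 1 else m - 1)"
      using assms by (intro prod.cong) auto
    also have "\<dots> = (m - 1) ^ card ({..<n} - A)"
      by (simp add: prod.If_cases Diff_eq)
    also have "card ({..<n} - A) = n - r"
      using that by (subst card_Diff_subset) (auto intro: finite_subset)
    finally show ?thesis .
  qed
  ultimately show ?thesis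
    using n_subsets[of "{..<n}" r] by simp
qed

lemma avg_cnt_eq:
  assumes "v < m"
  shows "avg ({..<n} \<rightarrow>\<^sub>E {..<m}) (\<lambda>x. of_bool (cnt n x v = r)) = binp n m r"
proof -
  have "(\<Sum>x\<in>{..<n} \<rightarrow>\<^sub>E {..<m}. of_bool (cnt n x v = r)) =
      real (card {x \<in> {..<n} \<rightarrow>\<^sub>E {..<m}. cnt n x v = r})"
    by (subst sum_of_bool_eq) (simp_all add: finite_PiE Int_def)
  then show ?thesis
    using assms by (simp add: avg_def card_cnt_eq binp_def card_PiE)
qed

lemma binp_nonneg: "0 < m \<Longrightarrow> 0 \<le> binp n m r"
  by (simp add: binp_def)

lemma binp_pos: "r \<le> n \<Longrightarrow> 2 \<le> m \<Longrightarrow> 0 < binp n m r"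
  by (simp add: binp_def)

text \<open>The exact ratio of the two probabilities is \<open>d * (m - 1) / (n - d + 1)\<close>;
  the second factor \<open>d\<close> comes from \<open>n <= d * (n - d + 1)\<close>, valid for
  \<open>1 <= d <= n\<close>.\<close>

lemma binp_pred_le:
  assumes "1 \<le> d" "d \<le> n" "2 \<le> m"
  shows "real n * binp n m (d - 1) \<le> (real d)\<^sup>2 * real m * binp n m d"
proof -
  obtain e where e: "d = Suc e" using assms by (cases d) auto
  have "n \<le> d * (n - e)"
  proof -
    obtain c where "n = d + c" using assms le_Suc_ex by blast
    then show ?thesis by (simp add: e algebra_simps)
  qed
  then have "n * (n choose e) \<le> d * (n - e) * (n choose e)" by (rule mult_right_mono) simp
  moreover have "(n - e) * (n choose e) = d * (n choose d)"
    unfolding e by (metis binomial_absorb_comp binomial_absorption mult.commute)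
  ultimately have "n * (n choose e) \<le> d * d * (n choose d)"
    by (simp add: mult.assoc)
  then have "real n * real (n choose e) \<le> (real d)\<^sup>2 * real (n choose d)"
    unfolding power2_eq_square by (metis of_nat_le_iff of_nat_mult)
  moreover have "(real m - 1) ^ (n - e) \<le> real m * (real m - 1) ^ (n - d)"
  proof -
    have "n - e = Suc (n - d)" using assms e by simp
    then show ?thesis using assms by (simp add: mult_right_mono)
  qed
  ultimately have "(real n * real (n choose e)) * (real m - 1) ^ (n - e) \<le>
      ((real d)\<^sup>2 * real (n choose d)) * (real m * (real m - 1) ^ (n - d))"
    by (rule mult_mono) (use assms in auto)
  then show ?thesis
    using assms by (simp add: binp_def e divide_right_mono algebra_simps)
qed

text \<open>The ratio of the probabilities has \<open>m - 1\<close> in its denominator, and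
  \<open>m <= 2 * (m - 1)\<close> gives the 2.\<close>

lemma binp_Suc_le:
  assumes "2 \<le> m"
  shows "real m * binp n m (Suc d) \<le> 2 * real n * binp n m d"
proof (cases "Suc d \<le> n")
  case True
  then have nd: "n - d = Suc (n - Suc d)" by simp
  have "(n choose Suc d) \<le> Suc d * (n choose Suc d)" by simp
  also have "\<dots> = (n - d) * (n choose d)"
    by (metis binomial_absorb_comp binomial_absorption)
  also have "\<dots> \<le> n * (n choose d)" by (intro mult_right_mono) simp_all
  finally have "real (n choose Suc d) \<le> real n * real (n choose d)"
    by (metis of_nat_le_iff of_nat_mult)
  moreover have "real m * (real m - 1) ^ (n - Suc d) \<le> 2 * (real m - 1) ^ (n - d)"
    unfolding nd power_Suc mult.assoc[symmetric] by (rule mult_right_mono) (use assms in auto)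
  ultimately have "real (n choose Suc d) * (real m * (real m - 1) ^ (n - Suc d)) \<le>
      (real n * real (n choose d)) * (2 * (real m - 1) ^ (n - d))"
    by (rule mult_mono) (use assms in auto)
  then show ?thesis
    by (simp add: binp_def divide_right_mono algebra_simps)
next
  case False
  then show ?thesis using assms by (simp add: binp_def binomial_eq_0)
qed

text \<open>Under the weight \<open>G\<close> the \<open>m - 1\<close> urns other than
  \<open>v\<close> are equally likely for ball \<open>l\<close>, and together they carry at most the
  whole mass. This replaces independence of the contents of \<open>u\<close> and
  \<open>v\<close>.\<close>

lemma avg_coordinate_le:
  fixes n m :: nat
  defines "Om \<equiv> {..<n} \<rightarrow>\<^sub>E {..<m}"
  assumes "l < n" "u < m" "v < m" "u \<noteq> v" "2 \<le> m"
    and G_nonneg: "\<And>x. x \<in> Om \<Longrightarrow> 0 \<le> G x"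
    and G_upd: "\<And>x w. x \<in> Om \<Longrightarrow> w < m \<Longrightarrow> w \<noteq> v \<Longrightarrow> x l \<noteq> v \<Longrightarrow> G (x(l := w)) = G x"
  shows "avg Om (\<lambda>x. of_bool (x l = u) * G x) \<le> 2 / real m * avg Om G"
proof -
  have eq: "avg Om (\<lambda>x. of_bool (x l = w) * G x) = avg Om (\<lambda>x. of_bool (x l = u) * G x)"
    if w: "w < m" "w \<noteq> v" for w
  proof -
    \<comment> \<open>Exchanges \<open>u\<close> and \<open>w\<close> for ball \<open>l\<close>
      only. Both differ from \<open>v\<close>, so \<open>G\<close> is unchanged wherever the
      indicators are nonzero.\<close>
    define h where "h = (\<lambda>x :: nat \<Rightarrow> nat. x(l := if x l = u then w else if x l = w then u else x l))"
    have "avg Om (\<lambda>x. of_bool (x l = w) * G x) = avg Om (\<lambda>x. of_bool (h x l = u) * G (h x))"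
    proof (rule avg_cong)
      fix x assume x: "x \<in> Om"
      show "of_bool (x l = w) * G x = of_bool (h x l = u) * G (h x)"
      proof (cases "x l = w")
        case True
        then show ?thesis using G_upd[OF x, of u] assms w by (auto simp: h_def)
      qed (auto simp: h_def)
    qed
    also have "\<dots> = avg Om (\<lambda>x. of_bool (x l = u) * G x)"
      by (rule avg_involution[where f = "\<lambda>x. of_bool (x l = u) * G x"])
        (use assms w in \<open>auto simp: h_def Om_def PiE_iff extensional_def fun_eq_iff\<close>)
    finally show ?thesis .
  qed
  have "(real m - 1) * avg Om (\<lambda>x. of_bool (x l = u) * G x)
      = (\<Sum>w\<in>{..<m} - {v}. avg Om (\<lambda>x. of_bool (x l = w) * G x))"
  proof -
    have "(\<Sum>w\<in>{..<m} - {v}. avg Om (\<lambda>x. of_bool (x l = w) * G x)) =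
        (\<Sum>w\<in>{..<m} - {v}. avg Om (\<lambda>x. of_bool (x l = u) * G x))"
      by (rule sum.cong) (auto intro: eq)
    then show ?thesis using assms(4,6) by (simp add: of_nat_diff)
  qed
  also have "\<dots> = avg Om (\<lambda>x. (\<Sum>w\<in>{..<m} - {v}. of_bool (x l = w)) * G x)"
    by (simp only: avg_sum sum_distrib_right)
  also have "\<dots> \<le> avg Om G"
    by (rule avg_mono, rule mult_left_le_one_le)
      (auto simp: G_nonneg sum_nonneg of_bool_def sum.delta')
  finally have le: "(real m - 1) * avg Om (\<lambda>x. of_bool (x l = u) * G x) \<le> avg Om G" .
  have "real m / 2 * avg Om (\<lambda>x. of_bool (x l = u) * G x) \<le> (real m - 1) * avg Om (\<lambda>x. of_bool (x l = u) * G x)"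
    using assms by (intro mult_right_mono avg_nonneg) (auto simp: G_nonneg)
  with le show ?thesis using assms by (simp add: field_simps)
qed

lemma cnt_fun_upd_other: "x l \<noteq> v \<Longrightarrow> w \<noteq> v \<Longrightarrow> cnt n (x(l := w)) v = cnt n x v"
  unfolding cnt_def by (rule arg_cong[where f = card]) auto

section \<open>Moments of one urn's load, weighted by the state of another urn\<close>

context
  fixes n m u v :: nat and h :: "nat \<Rightarrow> real"
  assumes uv: "u < m" "v < m" "u \<noteq> v" and m: "2 \<le> m" and h: "\<And>r. 0 \<le> h r"
begin

abbreviation (input) "Om \<equiv> {..<n} \<rightarrow>\<^sub>E {..<m}"

lemma avg_prescribed_le:
  assumes "J \<subseteq> {..<n}"
  shows "avg Om (\<lambda>x. of_bool (\<forall>i\<in>J. x i = u) * h (cnt n x v)) \<le>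
    (2 / real m) ^ card J * avg Om (\<lambda>x. h (cnt n x v))"
proof -
  have "finite J" using assms finite_subset by blast
  then show ?thesis using assms
  proof induction
    case (insert l J)
    let ?G = "\<lambda>x. of_bool (\<forall>i\<in>J. x i = u) * h (cnt n x v)"
    have "avg Om (\<lambda>x. of_bool (x l = u) * ?G x) \<le> 2 / real m * avg Om ?G"
    proof (rule avg_coordinate_le)
      fix x :: "nat \<Rightarrow> nat" and w assume "w \<noteq> v" "x l \<noteq> v"
      moreover have "(\<forall>i\<in>J. (x(l := w)) i = u) = (\<forall>i\<in>J. x i = u)"
        using insert by auto
      ultimately show "?G (x(l := w)) = ?G x"
        by (simp add: cnt_fun_upd_other)
    qed (use insert uv m h in auto)
    also have "\<dots> \<le> 2 / real m * ((2 / real m) ^ card J * avg Om (\<lambda>x. h (cnt n x v)))"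
      using insert by (intro mult_left_mono insert.IH) auto
    finally show ?case
      using insert by (simp add: of_bool_conj mult_ac)
  qed simp
qed

text \<open>One factor of the load is expanded over the balls \<open>l\<close>, and \<open>l\<close>
  joins \<open>J\<close>. A ball already in \<open>J\<close> costs nothing, a new one a factor
  \<open>2 / m\<close>, so the sum over \<open>l\<close> contributes
  \<open>card J + 2 * (n / m)\<close>.\<close>

lemma avg_prescribed_moment_le:
  assumes "J \<subseteq> {..<n}"
  shows "avg Om (\<lambda>x. of_bool (\<forall>i\<in>J. x i = u) * real (cnt n x u) ^ k * h (cnt n x v)) \<le>
    (2 / real m) ^ card J * (real (card J) + real k + 2 * (real n / real m)) ^ k * avg Om (\<lambda>x. h (cnt n x v))"
  using assms
proof (induction k arbitrary: J)
  case 0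
  then show ?case using avg_prescribed_le by simp
next
  case (Suc k)
  let ?A = "avg Om (\<lambda>x. h (cnt n x v))" and ?lam = "2 * (real n / real m)"
  have J: "finite J" using Suc finite_subset by blast
  have A: "0 \<le> ?A" by (rule avg_nonneg) (simp add: h)
  have "avg Om (\<lambda>x. of_bool (\<forall>i\<in>J. x i = u) * real (cnt n x u) ^ Suc k * h (cnt n x v))
     = (\<Sum>l<n. avg Om (\<lambda>x. of_bool (\<forall>i\<in>insert l J. x i = u) * real (cnt n x u) ^ k * h (cnt n x v)))"
  proof -
    have "of_bool (\<forall>i\<in>J. x i = u) * real (cnt n x u) ^ Suc k * h (cnt n x v)
      = (\<Sum>l<n. of_bool (\<forall>i\<in>insert l J. x i = u) * real (cnt n x u) ^ k * h (cnt n x v))" for x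
    proof -
      have "(\<Sum>l<n. of_bool (\<forall>i\<in>insert l J. x i = u) * real (cnt n x u) ^ k * h (cnt n x v))
        = (\<Sum>l<n. of_bool (x l = u) * (of_bool (\<forall>i\<in>J. x i = u) * real (cnt n x u) ^ k * h (cnt n x v)))"
        by (rule sum.cong) (simp_all add: of_bool_conj)
      also have "\<dots> = real (cnt n x u) * (of_bool (\<forall>i\<in>J. x i = u) * real (cnt n x u) ^ k * h (cnt n x v))"
        unfolding cnt_eq_sum[of n x u] by (rule sum_distrib_right[symmetric])
      finally show ?thesis by (simp add: mult_ac)
    qed
    then show ?thesis by (simp only: avg_sum)
  qed
  also have "\<dots> \<le> (\<Sum>l<n. (2 / real m) ^ card (insert l J) *
      ((real (card J) + real (Suc k) + ?lam) ^ k * ?A))"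
  proof (rule sum_mono)
    fix l assume l: "l \<in> {..<n}"
    have "avg Om (\<lambda>x. of_bool (\<forall>i\<in>insert l J. x i = u) * real (cnt n x u) ^ k * h (cnt n x v))
      \<le> (2 / real m) ^ card (insert l J) * (real (card (insert l J)) + real k + ?lam) ^ k * ?A"
      using Suc l by (intro Suc.IH) auto
    also have "\<dots> \<le> (2 / real m) ^ card (insert l J) * ((real (card J) + real (Suc k) + ?lam) ^ k * ?A)"
      unfolding mult.assoc
      using J A by (intro mult_left_mono mult_right_mono power_mono) (auto simp: card_insert_if)
    finally show "avg Om (\<lambda>x. of_bool (\<forall>i\<in>insert l J. x i = u) * real (cnt n x u) ^ k * h (cnt n x v))
      \<le> \<dots>" .
  qed
  also have "\<dots> = (\<Sum>l<n. (2 / real m) ^ card (insert l J)) * ((real (card J) + real (Suc k) + ?lam) ^ k * ?A)"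
    by (simp only: sum_distrib_right)
  also have "\<dots> \<le> ((2 / real m) ^ card J * (real (card J) + ?lam)) * ((real (card J) + real (Suc k) + ?lam) ^ k * ?A)"
  proof (rule mult_right_mono)
    have "(\<Sum>l<n. (2 / real m) ^ card (insert l J)) \<le>
       (\<Sum>l<n. (2 / real m) ^ card J * (of_bool (l \<in> J) + 2 / real m))"
      using J by (intro sum_mono) (auto simp: card_insert_if distrib_left mult_ac)
    also have "\<dots> = (2 / real m) ^ card J * ((\<Sum>l<n. of_bool (l \<in> J)) + ?lam)"
      by (simp add: sum_distrib_left[symmetric] sum.distrib)
    also have "(\<Sum>l<n. of_bool (l \<in> J)) = real (card J)"
      using Suc.prems by (simp add: Int_absorb1 Int_def[symmetric] Collect_mem_eq)
    finally show "(\<Sum>l<n. (2 / real m) ^ card (insert l J)) \<le> (2 / real m) ^ card J * (real (card J) + ?lam)" .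
  qed (use A in auto)
  also have "\<dots> \<le> (2 / real m) ^ card J * (real (card J) + real (Suc k) + ?lam) ^ Suc k * ?A"
    unfolding mult.assoc power_Suc
    by (intro mult_left_mono mult_right_mono) (use A in auto)
  finally show ?case .
qed

text \<open>The first ball expanded is always new, so a factor \<open>n / m\<close> survives outside
  the power; for small loads this factor is indispensable later.\<close>

lemma avg_moment_le:
  "avg Om (\<lambda>x. real (cnt n x u) ^ Suc k * h (cnt n x v)) \<le>
    2 * (real n / real m) * (real (Suc k) + 2 * (real n / real m)) ^ k * avg Om (\<lambda>x. h (cnt n x v))"
proof -
  have "avg Om (\<lambda>x. real (cnt n x u) ^ Suc k * h (cnt n x v))
      = (\<Sum>l<n. avg Om (\<lambda>x. of_bool (\<forall>i\<in>{l}. x i = u) * real (cnt n x u) ^ k * h (cnt n x v)))"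
    by (simp add: avg_sum[symmetric] sum_distrib_right[symmetric] cnt_eq_sum[symmetric])
  also have "\<dots> \<le> (\<Sum>l<n. (2 / real m) ^ card {l} * (real (card {l}) + real k + 2 * (real n / real m)) ^ k
      * avg Om (\<lambda>x. h (cnt n x v)))"
    by (intro sum_mono avg_prescribed_moment_le) auto
  also have "\<dots> = 2 * (real n / real m) * (real (Suc k) + 2 * (real n / real m)) ^ k * avg Om (\<lambda>x. h (cnt n x v))"
    by (simp add: add_ac)
  finally show ?thesis .
qed

end

section \<open>Lower bound for the variance\<close>

text \<open>The difference \<open>v k\<close> is odd under its own involution and invariant under
  the others, so distinct differences are orthogonal; oddness also makes the covariance of
  \<open>F\<close> with \<open>v k\<close> half the second moment of \<open>v k\<close>.\<close>

lemma var_ge_involutions: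
  assumes A: "finite A" "A \<noteq> {}" and K: "finite K"
    and mem: "\<And>k x. k \<in> K \<Longrightarrow> x \<in> A \<Longrightarrow> \<tau> k x \<in> A"
    and inv: "\<And>k x. k \<in> K \<Longrightarrow> x \<in> A \<Longrightarrow> \<tau> k (\<tau> k x) = x"
    and local: "\<And>k l x. k \<in> K \<Longrightarrow> l \<in> K \<Longrightarrow> k \<noteq> l \<Longrightarrow> x \<in> A \<Longrightarrow>
      F (\<tau> k x) - F (\<tau> l (\<tau> k x)) = F x - F (\<tau> l x)"
  shows "(\<Sum>k\<in>K. avg A (\<lambda>x. (F x - F (\<tau> k x))\<^sup>2)) / 4 \<le> var A F"
proof -
  define v where "v = (\<lambda>k x. F x - F (\<tau> k x))"
  let ?S = "\<Sum>k\<in>K. avg A (\<lambda>x. (v k x)\<^sup>2)"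
  have anti: "v k (\<tau> k x) = - v k x" if "k \<in> K" "x \<in> A" for k x
    using that by (simp add: v_def inv)
  have loc: "v l (\<tau> k x) = v l x" if "k \<in> K" "l \<in> K" "k \<noteq> l" "x \<in> A" for k l x
    unfolding v_def by (rule local) (use that in auto)
  have vv: "avg A (\<lambda>x. v k x * v l x) = 0" if kl: "k \<in> K" "l \<in> K" "k \<noteq> l" for k l
  proof -
    have "avg A (\<lambda>x. v k x * v l x) = avg A (\<lambda>x. v k (\<tau> k x) * v l (\<tau> k x))"
      by (rule avg_involution[symmetric]) (use kl mem inv in auto)
    also have "\<dots> = avg A (\<lambda>x. - (v k x * v l x))"
      by (rule avg_cong) (use kl in \<open>simp add: anti loc\<close>)
    finally show ?thesis by (simp add: avg_uminus)
  qed
  have Fv: "avg A (\<lambda>x. (F x - c) * v k x) = avg A (\<lambda>x. (v k x)\<^sup>2) / 2" if k: "k \<in> K" for k c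
  proof -
    have "avg A (\<lambda>x. (F x - c) * v k x) = avg A (\<lambda>x. (F (\<tau> k x) - c) * v k (\<tau> k x))"
      by (rule avg_involution[symmetric]) (use k mem inv in auto)
    also have "\<dots> = avg A (\<lambda>x. (v k x)\<^sup>2 - (F x - c) * v k x)"
      by (rule avg_cong) (use k anti in \<open>simp add: power2_eq_square, simp add: v_def algebra_simps\<close>)
    finally show ?thesis by (simp add: avg_diff)
  qed
  have "avg A (\<lambda>x. (\<Sum>k\<in>K. v k x)\<^sup>2) = (\<Sum>k\<in>K. \<Sum>l\<in>K. avg A (\<lambda>x. v k x * v l x))"
    by (simp add: power2_eq_square sum_product avg_sum)
  also have "\<dots> = (\<Sum>k\<in>K. \<Sum>l\<in>K. if l = k then avg A (\<lambda>x. (v k x)\<^sup>2) else 0)"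
    by (intro sum.cong refl) (auto simp: vv power2_eq_square)
  also have "\<dots> = ?S" using K by simp
  finally have V: "avg A (\<lambda>x. (\<Sum>k\<in>K. v k x)\<^sup>2) = ?S" .
  have FV: "avg A (\<lambda>x. (F x - avg A F) * (\<Sum>k\<in>K. v k x)) = ?S / 2"
    by (simp add: sum_distrib_left avg_sum Fv sum_divide_distrib)
  \<comment> \<open>Projection of \<open>F\<close> onto the sum of the differences; the coefficient
    1/2 minimises \<open>- c * ?S + c^2 * ?S\<close>.\<close>
  have "0 \<le> avg A (\<lambda>x. (F x - avg A F - (\<Sum>k\<in>K. v k x) / 2)\<^sup>2)"
    by (rule avg_nonneg) simp
  also have "\<dots> = avg A (\<lambda>x. (F x - avg A F)\<^sup>2 - (F x - avg A F) * (\<Sum>k\<in>K. v k x) + (\<Sum>k\<in>K. v k x)\<^sup>2 * (1 / 4))"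
    by (rule avg_cong) (simp add: power2_eq_square field_simps)
  also have "\<dots> = var A F - ?S / 4"
    unfolding avg_add avg_diff avg_cmult_right FV V var_def by simp
  finally show ?thesis by (simp add: v_def)
qed

section \<open>Flips within the pairs of urns \<open>2 * k\<close> and
  \<open>2 * k + 1\<close>\<close>

definition occF :: "nat \<Rightarrow> nat \<Rightarrow> nat \<Rightarrow> (nat \<Rightarrow> nat) \<Rightarrow> real" where
  "occF n m d x = (\<Sum>u<m. of_bool (cnt n x u = d))"

definition partner :: "nat \<Rightarrow> nat" where
  "partner u = (if even u then u + 1 else u - 1)"

lemma partner_div2: "partner u div 2 = u div 2"
  by (auto simp: partner_def elim!: evenE oddE)

lemma partner_partner: "partner (partner u) = u"
  by (auto simp: partner_def)

text \<open>Depends only on which pair each ball is in, so flips preserve it. That makes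
  \<open>flip_ball\<close> an involution and lets flips of different pairs commute; flipping, say,
  the first ball of one urn would not have this property.\<close>

definition pair_rank :: "nat \<Rightarrow> (nat \<Rightarrow> nat) \<Rightarrow> nat \<Rightarrow> nat" where
  "pair_rank k x i = card {l \<in> {..<i}. x l div 2 = k}"

definition flip_ball :: "nat \<Rightarrow> nat \<Rightarrow> nat \<Rightarrow> (nat \<Rightarrow> nat) \<Rightarrow> nat \<Rightarrow> nat" where
  "flip_ball n t k x = (\<lambda>i. if i < n \<and> x i div 2 = k \<and> pair_rank k x i = t then partner (x i) else x i)"

lemma flip_ball_div2: "flip_ball n t k x i div 2 = x i div 2"
  by (simp add: flip_ball_def partner_div2)

lemma pair_rank_flip_ball: "pair_rank k (flip_ball n t l x) = pair_rank k x"
  by (simp add: pair_rank_def flip_ball_div2 fun_eq_iff)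

lemma flip_ball_flip_ball: "flip_ball n t k (flip_ball n t k x) = x"
  unfolding flip_ball_def[of n t k "flip_ball n t k x"] flip_ball_div2 pair_rank_flip_ball
  by (auto simp: flip_ball_def partner_partner)

lemma flip_ball_commute:
  assumes "k \<noteq> l"
  shows "flip_ball n t k (flip_ball n t l x) = flip_ball n t l (flip_ball n t k x)"
  unfolding flip_ball_def[of n t k "flip_ball n t l x"] flip_ball_def[of n t l "flip_ball n t k x"]
    flip_ball_div2 pair_rank_flip_ball
  using assms by (auto simp: flip_ball_def)

lemma flip_ball_mem:
  assumes "k < m div 2" "x \<in> {..<n} \<rightarrow>\<^sub>E {..<m}"
  shows "flip_ball n t k x \<in> {..<n} \<rightarrow>\<^sub>E {..<m}"
proof -
  have "partner u < m" if "u div 2 = k" "u < m" for u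
    using that assms(1) by (auto simp: partner_def elim!: evenE)
  then show ?thesis
    using assms(2) by (auto simp: flip_ball_def PiE_iff extensional_def)
qed

lemma cnt_flip_ball_other:
  assumes "u div 2 \<noteq> k"
  shows "cnt n (flip_ball n t k x) u = cnt n x u"
proof -
  have "flip_ball n t k x i = u \<longleftrightarrow> x i = u" for i
    using assms partner_div2[of "x i"] by (auto simp: flip_ball_def)
  then show ?thesis by (simp add: cnt_def)
qed

lemma occF_split_pair:
  assumes "k < m div 2"
  shows "occF n m d x = of_bool (cnt n x (2 * k) = d) + of_bool (cnt n x (2 * k + 1) = d)
    + (\<Sum>u\<in>{u\<in>{..<m}. u div 2 \<noteq> k}. of_bool (cnt n x u = d))"
proof -
  have set: "{..<m} = insert (2 * k) (insert (2 * k + 1) {u\<in>{..<m}. u div 2 \<noteq> k})"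
    using assms by auto
  show ?thesis
    unfolding occF_def by (subst set, subst sum.insert, simp, simp, subst sum.insert) auto
qed

lemma occF_flip_diff:
  assumes "k < m div 2"
  shows "occF n m d x - occF n m d (flip_ball n t k x) =
    of_bool (cnt n x (2 * k) = d) + of_bool (cnt n x (2 * k + 1) = d)
    - of_bool (cnt n (flip_ball n t k x) (2 * k) = d) - of_bool (cnt n (flip_ball n t k x) (2 * k + 1) = d)"
proof -
  have "(\<Sum>u\<in>{u\<in>{..<m}. u div 2 \<noteq> k}. of_bool (cnt n (flip_ball n t k x) u = d)) =
      (\<Sum>u\<in>{u\<in>{..<m}. u div 2 \<noteq> k}. of_bool (cnt n x u = d) :: real)"
    by (rule sum.cong) (simp_all add: cnt_flip_ball_other)
  then show ?thesis unfolding occF_split_pair[OF assms] by simp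
qed

lemma occF_flip_local:
  assumes "l < m div 2" "k \<noteq> l"
  shows "occF n m d (flip_ball n t k x) - occF n m d (flip_ball n t l (flip_ball n t k x))
    = occF n m d x - occF n m d (flip_ball n t l x)"
proof -
  have "cnt n (flip_ball n t k y) (2 * l) = cnt n y (2 * l)"
    "cnt n (flip_ball n t k y) (2 * l + 1) = cnt n y (2 * l + 1)" for y
    using assms by (auto intro!: cnt_flip_ball_other)
  then show ?thesis
    unfolding occF_flip_diff[OF assms(1)] by (simp only: flip_ball_commute[OF assms(2)[symmetric]])
qed

lemma pair_rank_inj:
  assumes "x i div 2 = k" "x j div 2 = k" "pair_rank k x i = pair_rank k x j"
  shows "i = j"
proof -
  have "pair_rank k x i < pair_rank k x j" if "i < j" "x i div 2 = k" for i j
    unfolding pair_rank_def by (rule psubset_card_mono) (use that in auto)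
  then show ?thesis using assms by (metis less_irrefl linorder_cases)
qed

lemma flip_ball_eq_upd:
  assumes "i < n" "x i div 2 = k"
  shows "flip_ball n (pair_rank k x i) k x = x(i := partner (x i))"
  using assms pair_rank_inj[of x _ k i] by (auto simp: flip_ball_def fun_eq_iff)

lemma cnt_upd_to:
  assumes "i < n" "x i \<noteq> w"
  shows "cnt n (x(i := w)) w = Suc (cnt n x w)"
proof -
  have "{j \<in> {..<n}. (x(i := w)) j = w} = insert i {j \<in> {..<n}. x j = w}" using assms by auto
  then show ?thesis using assms by (simp add: cnt_def)
qed

lemma cnt_upd_from:
  assumes "i < n" "x i \<noteq> w"
  shows "cnt n x (x i) = Suc (cnt n (x(i := w)) (x i))"
  using cnt_upd_to[of i n "x(i := w)" "x i"] assms by simp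

text \<open>A move between the two urns destroys the count at \<open>2 * k\<close>. It is
  compensated only if a ball leaving \<open>2 * k\<close> finds \<open>b = d - 1\<close>, or if a
  ball entering it comes from \<open>b = d + 1\<close>; in these cases a ball moving the other way
  works. The pair then holds at most \<open>2 * d + 1\<close> balls, which bounds the rank.\<close>

lemma ex_flip_changes:
  assumes "2 \<le> d" "k < m div 2" "cnt n x (2 * k) = d"
  shows "\<exists>t<2 * d + 2. 1 \<le> (occF n m d x - occF n m d (flip_ball n t k x))\<^sup>2"
proof -
  define b where "b = cnt n x (2 * k + 1)"
  have step: "\<exists>t<2 * d + 2. 1 \<le> (occF n m d x - occF n m d (flip_ball n t k x))\<^sup>2"
    if i: "i < n" "x i div 2 = k" "pair_rank k x i < 2 * d + 2"
      "x i = 2 * k \<Longrightarrow> b \<noteq> d - 1" "x i = 2 * k + 1 \<Longrightarrow> b \<noteq> d + 1" for i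
  proof -
    have "x i = 2 * k \<or> x i = 2 * k + 1" using i(2) by auto
    then have "1 \<le> occF n m d x - occF n m d (flip_ball n (pair_rank k x i) k x)"
    proof
      assume xi: "x i = 2 * k"
      then have "cnt n (x(i := 2 * k + 1)) (2 * k + 1) = Suc b" "d = Suc (cnt n (x(i := 2 * k + 1)) (2 * k))"
        using cnt_upd_to[of i n x "2 * k + 1"] cnt_upd_from[of i n x "2 * k + 1"] i assms by (auto simp: b_def)
      then show ?thesis
        unfolding occF_flip_diff[OF assms(2)]
        unfolding flip_ball_eq_upd[of i n x k, OF i(1,2)] assms(3) b_def[symmetric]
        using xi i(4) by (simp add: partner_def)
    next
      assume xi: "x i = 2 * k + 1"
      then have "cnt n (x(i := 2 * k)) (2 * k) = Suc d" "b = Suc (cnt n (x(i := 2 * k)) (2 * k + 1))"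
        using cnt_upd_to[of i n x "2 * k"] cnt_upd_from[of i n x "2 * k"] i assms by (auto simp: b_def)
      then show ?thesis
        unfolding occF_flip_diff[OF assms(2)]
        unfolding flip_ball_eq_upd[of i n x k, OF i(1,2)] assms(3) b_def[symmetric]
        using xi i(5) by (simp add: partner_def)
    qed
    then show ?thesis using i(3) by (metis one_le_power)
  qed
  have rank_le: "pair_rank k x i \<le> d + b" if "i < n" for i
  proof -
    have "pair_rank k x i \<le> card ({l \<in> {..<n}. x l = 2 * k} \<union> {l \<in> {..<n}. x l = 2 * k + 1})"
      unfolding pair_rank_def by (rule card_mono) (use that in auto)
    also have "\<dots> \<le> d + b"
      using card_Un_le[of "{l \<in> {..<n}. x l = 2 * k}" "{l \<in> {..<n}. x l = 2 * k + 1}"] assms(3)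
      by (simp add: b_def cnt_def)
    finally show ?thesis .
  qed
  have ex: "\<exists>i<n. x i = u" if "cnt n x u > 0" for u
    using that by (auto simp: cnt_def card_gt_0_iff)
  consider "b = d - 1" | "b = d + 1" | "b \<noteq> d - 1" "b \<noteq> d + 1" by blast
  then show ?thesis
  proof cases
    case 1
    \<comment> \<open>Since \<open>d >= 2\<close>, the urn with \<open>b = d - 1\<close> balls is
      not empty.\<close>
    then obtain i where i: "i < n" "x i = 2 * k + 1" using ex[of "2 * k + 1"] assms by (auto simp: b_def)
    then show ?thesis using rank_le[OF i(1)] 1 by (intro step[of i]) auto
  next
    case 2
    then obtain i where i: "i < n" "x i = 2 * k" using ex[of "2 * k"] assms by auto
    then show ?thesis using rank_le[OF i(1)] 2 by (intro step[of i]) auto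
  next
    case 3
    \<comment> \<open>Here \<open>b\<close> has no bound, so the first ball of the pair is taken;
      either direction of its move works and its rank is 0.\<close>
    define i where "i = (LEAST i. i < n \<and> x i div 2 = k)"
    have "\<exists>i. i < n \<and> x i div 2 = k" using ex[of "2 * k"] assms by auto
    then have i: "i < n" "x i div 2 = k" unfolding i_def by (metis (mono_tags, lifting) LeastI_ex)+
    have "{l \<in> {..<i}. x l div 2 = k} = {}"
      using not_less_Least[of _ "\<lambda>i. i < n \<and> x i div 2 = k"] i(1) unfolding i_def[symmetric] by auto
    then have "pair_rank k x i = 0" by (simp add: pair_rank_def)
    then show ?thesis using i 3 by (intro step[of i]) auto
  qed
qed

text \<open>The factor is \<open>3 * 4 * (2 * d + 2)\<close>: at least \<open>m / 3\<close> pairs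
  (worst case \<open>m = 3\<close>), the 4 of the projection bound, and one application of it for
  each rank.\<close>

theorem occ_var_ge:
  assumes "2 \<le> d" "2 \<le> m"
  shows "real m * binp n m d \<le> 24 * (real d + 1) * var ({..<n} \<rightarrow>\<^sub>E {..<m}) (occF n m d)"
proof -
  let ?O = "{..<n} \<rightarrow>\<^sub>E {..<m}" and ?K = "{..<m div 2}" and ?F = "occF n m d"
  have O: "finite ?O" "?O \<noteq> {}" using occ_nonempty[of m n] assms by auto
  have *: "(\<Sum>k\<in>?K. avg ?O (\<lambda>x. (?F x - ?F (flip_ball n t k x))\<^sup>2)) / 4 \<le> var ?O ?F" for t
    by (rule var_ge_involutions) (use O in \<open>auto simp: flip_ball_mem flip_ball_flip_ball occF_flip_local\<close>)
  have "real m / 3 \<le> real (m div 2)"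
    using assms by (cases "even m") (auto elim!: evenE oddE)
  then have "real m / 3 * binp n m d \<le> (\<Sum>k\<in>?K. binp n m d)"
    using mult_right_mono[of "real m / 3" _ "binp n m d"] binp_nonneg[of m n d] assms by simp
  also have "\<dots> = (\<Sum>k\<in>?K. avg ?O (\<lambda>x. of_bool (cnt n x (2 * k) = d)))"
    by (rule sum.cong) (simp_all add: avg_cnt_eq)
  also have "\<dots> \<le> (\<Sum>k\<in>?K. avg ?O (\<lambda>x. \<Sum>t<2 * d + 2. (?F x - ?F (flip_ball n t k x))\<^sup>2))"
  proof (intro sum_mono avg_mono)
    fix k x assume k: "k \<in> ?K"
    show "of_bool (cnt n x (2 * k) = d) \<le> (\<Sum>t<2 * d + 2. (?F x - ?F (flip_ball n t k x))\<^sup>2)"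
    proof (cases "cnt n x (2 * k) = d")
      case True
      then obtain t where t: "t < 2 * d + 2" "1 \<le> (?F x - ?F (flip_ball n t k x))\<^sup>2"
        using ex_flip_changes assms k by blast
      then have "1 \<le> (\<Sum>t<2 * d + 2. (?F x - ?F (flip_ball n t k x))\<^sup>2)"
        using member_le_sum[of t "{..<2 * d + 2}" "\<lambda>t. (?F x - ?F (flip_ball n t k x))\<^sup>2"] by auto
      then show ?thesis using True by simp
    qed (simp add: sum_nonneg)
  qed
  also have "\<dots> = (\<Sum>t<2 * d + 2. \<Sum>k\<in>?K. avg ?O (\<lambda>x. (?F x - ?F (flip_ball n t k x))\<^sup>2))"
    unfolding avg_sum by (rule sum.swap)
  also have "\<dots> \<le> (\<Sum>t<2 * d + 2. 4 * var ?O ?F)"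
    by (rule sum_mono) (use * in \<open>simp add: field_simps\<close>)
  finally show ?thesis by (simp add: field_simps)
qed

section \<open>Locality of the increments\<close>

lemma avg_of_bool_coordinate:
  fixes n m :: nat
  assumes "i < n" "u < m"
  shows "avg ({..<n} \<rightarrow>\<^sub>E {..<m}) (\<lambda>x. of_bool (x i = u)) = 1 / real m"
proof -
  have "{x \<in> {..<n} \<rightarrow>\<^sub>E {..<m}. x i = u} = PiE {..<n} (\<lambda>l. if l = i then {u} else {..<m})"
    (is "?L = ?R")
  proof (rule set_eqI)
    fix x
    have "(\<forall>l\<in>{..<n}. x l \<in> (if l = i then {u} else {..<m})) \<longleftrightarrow>
        (\<forall>l\<in>{..<n}. x l \<in> {..<m}) \<and> x i = u"
      using assms by (metis lessThan_iff singletonD singletonI)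
    then show "x \<in> ?L \<longleftrightarrow> x \<in> ?R"
      unfolding mem_Collect_eq PiE_iff by blast
  qed
  then have "card {x \<in> {..<n} \<rightarrow>\<^sub>E {..<m}. x i = u} = (\<Prod>l<n. if l = i then 1 else m)"
    by (simp only: card_PiE finite_lessThan) (intro prod.cong, auto)
  also have "\<dots> = m ^ (n - 1)"
    using assms by (simp add: prod.If_cases Int_absorb1 Diff_eq[symmetric])
  finally have card: "card {x \<in> {..<n} \<rightarrow>\<^sub>E {..<m}. x i = u} = m ^ (n - 1)" .
  have "(\<Sum>x\<in>{..<n} \<rightarrow>\<^sub>E {..<m}. of_bool (x i = u)) = real (card {x \<in> {..<n} \<rightarrow>\<^sub>E {..<m}. x i = u})"
    by (subst sum_of_bool_eq) (simp_all add: finite_PiE Int_def)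
  moreover have "real m ^ n = real m * real m ^ (n - 1)"
    using assms by (metis Suc_diff_1 gr_zeroI not_less_zero power_Suc)
  ultimately show ?thesis
    using assms by (simp add: avg_def card card_PiE)
qed

lemma sum_of_bool_mult_delta:
  fixes g :: "nat \<Rightarrow> real"
  shows "v < m \<Longrightarrow> (\<Sum>u<m. of_bool (v = u) * g u) = g v"
  by (subst sum.remove[of _ v]) (auto intro!: sum.neutral)

lemma avg_coordinate:
  fixes n m :: nat
  assumes "i < n"
  shows "avg ({..<n} \<rightarrow>\<^sub>E {..<m}) (\<lambda>x. g (x i)) = (\<Sum>u<m. g u) / real m"
proof -
  have "avg ({..<n} \<rightarrow>\<^sub>E {..<m}) (\<lambda>x. g (x i)) =
      avg ({..<n} \<rightarrow>\<^sub>E {..<m}) (\<lambda>x. \<Sum>u<m. of_bool (x i = u) * g u)"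
    using assms by (intro avg_cong sum_of_bool_mult_delta[symmetric]) auto
  also have "\<dots> = (\<Sum>u<m. 1 / real m * g u)"
    unfolding avg_sum avg_cmult_right
    by (rule sum.cong) (use assms in \<open>simp_all add: avg_of_bool_coordinate\<close>)
  finally show ?thesis by (simp add: sum_divide_distrib)
qed

lemma sum_over_coordinates:
  fixes n m :: nat
  assumes "x \<in> {..<n} \<rightarrow>\<^sub>E {..<m}"
  shows "(\<Sum>i<n. g (x i)) = (\<Sum>u<m. real (cnt n x u) * g u)"
proof -
  have "(\<Sum>u<m. real (cnt n x u) * g u) = (\<Sum>i<n. \<Sum>u<m. of_bool (x i = u) * g u)"
    unfolding cnt_eq_sum sum_distrib_right by (rule sum.swap)
  also have "\<dots> = (\<Sum>i<n. g (x i))"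
    by (rule sum.cong) (use assms in \<open>auto simp: sum_of_bool_mult_delta PiE_iff\<close>)
  finally show ?thesis by simp
qed

section \<open>Effect of moving one ball\<close>

definition cnt_wo :: "nat \<Rightarrow> nat \<Rightarrow> (nat \<Rightarrow> 'v) \<Rightarrow> 'v \<Rightarrow> nat" where
  "cnt_wo n j x u = card {i \<in> {..<n} - {j}. x i = u}"

lemma cnt_eq_cnt_wo:
  assumes "j < n"
  shows "cnt n x u = cnt_wo n j x u + of_bool (x j = u)"
proof -
  have "{i \<in> {..<n}. x i = u} = (if x j = u then insert j else id) {i \<in> {..<n} - {j}. x i = u}"
    using assms by auto
  then show ?thesis by (auto simp: cnt_def cnt_wo_def)
qed

lemma cnt_wo_upd: "cnt_wo n j (x(j := w)) u = cnt_wo n j x u"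
  unfolding cnt_wo_def by (rule arg_cong[where f = card]) auto

lemma cnt_wo_cong:
  "(\<And>l. l < n \<Longrightarrow> (x l = u) = (y l = u)) \<Longrightarrow> cnt_wo n j x u = cnt_wo n j y u"
  unfolding cnt_wo_def by (rule arg_cong[where f = card]) auto

text \<open>The effect on the statistic of adding a ball to an urn that holds \<open>c\<close> balls.\<close>
definition gain :: "nat \<Rightarrow> nat \<Rightarrow> real" where
  "gain d c = of_bool (Suc c = d) - of_bool (c = d)"

lemma abs_gain_le: "\<bar>gain d c\<bar> \<le> 1"
  by (auto simp: gain_def)

text \<open>The first term does not see where ball \<open>j\<close> lies, so moving it changes only
  one value of \<open>gain\<close>.\<close>

lemma occF_eq_gain:
  assumes "j < n" "x j < m"
  shows "occF n m d x = (\<Sum>u<m. of_bool (cnt_wo n j x u = d)) + gain d (cnt_wo n j x (x j))"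
proof -
  have "occF n m d x = (\<Sum>u<m. of_bool (cnt_wo n j x u = d) + of_bool (x j = u) * gain d (cnt_wo n j x u))"
    unfolding occF_def by (rule sum.cong) (auto simp: cnt_eq_cnt_wo[OF assms(1)] gain_def)
  then show ?thesis
    using assms by (simp add: sum.distrib sum_of_bool_mult_delta)
qed

lemma occF_diff_upd:
  assumes "j < n" "x j < m" "w < m"
  shows "occF n m d x - occF n m d (x(j := w)) = gain d (cnt_wo n j x (x j)) - gain d (cnt_wo n j x w)"
  using occF_eq_gain[of j n x m d] occF_eq_gain[of j n "x(j := w)" m d] assms
  by (simp add: cnt_wo_upd)

lemma first_copy_swap:
  "j < n \<Longrightarrow> first_copy n (swap_on {j} Z) = (first_copy n Z)(j := snd (Z j))"
  by (auto simp: first_copy_def swap_on_def fun_eq_iff)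

lemma hybrid_Suc_upd: "j < n \<Longrightarrow> hybrid n (Suc j) Z = (hybrid n j Z)(j := snd (Z j))"
  by (auto simp: hybrid_def first_copy_def swap_on_def fun_eq_iff)

lemma hybrid_diag: "j < n \<Longrightarrow> hybrid n j Z j = fst (Z j)"
  by (simp add: hybrid_def first_copy_def swap_on_def)

lemma first_copy_apply: "j < n \<Longrightarrow> first_copy n Z j = fst (Z j)"
  by (simp add: first_copy_def)

lemma hybrid_full_apply: "j < n \<Longrightarrow> hybrid n n Z j = snd (Z j)"
  by (simp add: hybrid_def first_copy_def swap_on_def)

lemma avg_hybrid_full:
  assumes "finite V" "V \<noteq> {}"
  shows "avg ({..<n} \<rightarrow>\<^sub>E V \<times> V) (\<lambda>Z. f (hybrid n n Z)) = avg ({..<n} \<rightarrow>\<^sub>E V) f"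
  using avg_copies[of n V "\<lambda>x y. f y"] assms
  by (simp add: avg_const finite_PiE PiE_eq_empty_iff)

lemma sum_list_power2_le: "(sum_list xs)\<^sup>2 \<le> real (length xs) * sum_list (map (\<lambda>x. x\<^sup>2) xs)"
proof (induction xs)
  case (Cons a xs)
  have "2 * a * sum_list xs \<le> real (length xs) * a\<^sup>2 + sum_list (map (\<lambda>x. x\<^sup>2) xs)"
  proof (induction xs)
    case (Cons b xs)
    then show ?case using sum_squares_bound[of a b] by (simp add: algebra_simps)
  qed simp
  with Cons show ?case by (simp add: power2_eq_square algebra_simps)
qed simp

locale occupancy =
  fixes n m d :: nat
  assumes d: "2 \<le> d" and dn: "d \<le> n" and m: "2 \<le> m"
begin

sublocale stein_pairs "{..<m}" n "occF n m d"
  by unfold_locales (use m in \<open>auto simp: lessThan_empty_iff\<close>)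

lemma D_eq:
  assumes "Z \<in> P2" "j < n"
  shows "D j Z = gain d (cnt_wo n j (first_copy n Z) (fst (Z j))) - gain d (cnt_wo n j (first_copy n Z) (snd (Z j)))"
  using occF_diff_upd[of j n "first_copy n Z" m "snd (Z j)" d] assms
  by (auto simp: D_def first_copy_swap first_copy_apply PiE_iff mem_Times_iff)

lemma D'_eq:
  assumes "Z \<in> P2" "j < n"
  shows "D' j Z = gain d (cnt_wo n j (hybrid n j Z) (fst (Z j))) - gain d (cnt_wo n j (hybrid n j Z) (snd (Z j)))"
  using occF_diff_upd[of j n "hybrid n j Z" m "snd (Z j)" d] assms
  by (auto simp: D'_def hybrid_Suc_upd hybrid_diag PiE_iff mem_Times_iff)

lemma abs_D_le: "Z \<in> P2 \<Longrightarrow> j < n \<Longrightarrow> \<bar>D j Z\<bar> \<le> 2"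
  using abs_gain_le[of d "cnt_wo n j (first_copy n Z) (fst (Z j))"]
    abs_gain_le[of d "cnt_wo n j (first_copy n Z) (snd (Z j))"] by (simp add: D_eq)

lemma abs_D'_le: "Z \<in> P2 \<Longrightarrow> j < n \<Longrightarrow> \<bar>D' j Z\<bar> \<le> 2"
  using abs_gain_le[of d "cnt_wo n j (hybrid n j Z) (fst (Z j))"]
    abs_gain_le[of d "cnt_wo n j (hybrid n j Z) (snd (Z j))"] by (simp add: D'_eq)

section \<open>Influence of resampling the pair of positions of one ball\<close>

definition touch :: "nat \<Rightarrow> nat \<Rightarrow> (nat \<Rightarrow> nat \<times> nat) \<Rightarrow> real" where
  "touch u j Z = of_bool ((u = fst (Z j) \<or> u = snd (Z j)) \<and> D j Z \<noteq> 0)"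

text \<open>Counts the balls whose summand can react, through urn \<open>u\<close>, to a resampling
  of another ball.\<close>

definition H :: "nat \<Rightarrow> (nat \<Rightarrow> nat \<times> nat) \<Rightarrow> real" where
  "H u Z = (\<Sum>j<n. touch u j Z)"

definition urns :: "nat \<times> nat \<Rightarrow> nat \<times> nat \<Rightarrow> nat list" where
  "urns a b = [fst a, snd a, fst b, snd b]"

text \<open>Both positions of ball \<open>i\<close>, before and after, must be listed: a hybrid may
  read either copy of it.\<close>

lemma D_upd_other:
  assumes "Z \<in> P2" "Z(i := w) \<in> P2" "j < n" "i \<noteq> j"
    and "fst (Z j) \<notin> set (urns (Z i) w)" "snd (Z j) \<notin> set (urns (Z i) w)"
  shows "D j (Z(i := w)) = D j Z" "D' j (Z(i := w)) = D' j Z"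
proof -
  have "cnt_wo n j (first_copy n (Z(i := w))) u = cnt_wo n j (first_copy n Z) u"
    "cnt_wo n j (hybrid n j (Z(i := w))) u = cnt_wo n j (hybrid n j Z) u"
    if "u \<notin> set (urns (Z i) w)" for u
    by (rule cnt_wo_cong; use that in \<open>auto simp: urns_def first_copy_def hybrid_def swap_on_def\<close>)+
  then show "D j (Z(i := w)) = D j Z" "D' j (Z(i := w)) = D' j Z"
    using assms by (simp_all add: D_eq D'_eq)
qed

text \<open>Treats \<open>T\<close> and \<open>T_abs\<close> together. The functions \<phi> used
  vanish when \<open>D\<close> does, so only \<open>D\<close>, which reads the first copy and the
  replacement of ball \<open>j\<close>, decides which summands count.\<close>

definition R :: "(real \<Rightarrow> real \<Rightarrow> real) \<Rightarrow> (nat \<Rightarrow> nat \<times> nat) \<Rightarrow> real" where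
  "R \<phi> Z = (\<Sum>j<n. \<phi> (D j Z) (D' j Z))"

context
  fixes \<phi> :: "real \<Rightarrow> real \<Rightarrow> real"
  assumes phi: "\<And>a b. \<bar>a\<bar> \<le> 2 \<Longrightarrow> \<bar>b\<bar> \<le> 2 \<Longrightarrow> \<bar>\<phi> a b\<bar> \<le> 4 * of_bool (a \<noteq> 0)"
begin

lemma phi_le_touch:
  assumes "Z \<in> P2" "j < n" "fst (Z j) \<in> set us \<or> snd (Z j) \<in> set us"
  shows "\<bar>\<phi> (D j Z) (D' j Z)\<bar> \<le> 4 * (\<Sum>u\<leftarrow>us. touch u j Z)"
proof -
  obtain u where u: "u \<in> set us" "u = fst (Z j) \<or> u = snd (Z j)" using assms by blast
  have "\<bar>\<phi> (D j Z) (D' j Z)\<bar> \<le> 4 * touch u j Z"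
    using phi[OF abs_D_le[OF assms(1,2)] abs_D'_le[OF assms(1,2)]] u by (simp add: touch_def)
  also have "touch u j Z \<le> (\<Sum>u\<leftarrow>us. touch u j Z)"
    by (rule member_le_sum_list) (use u in \<open>auto simp: touch_def\<close>)
  finally show ?thesis by simp
qed

lemma R_upd_diff:
  assumes Z: "Z \<in> P2" and Zi: "Z(i := w) \<in> P2"
  shows "\<bar>R \<phi> Z - R \<phi> (Z(i := w))\<bar> \<le> 4 * (\<Sum>u\<leftarrow>urns (Z i) w. H u Z + H u (Z(i := w)))"
proof -
  let ?U = "urns (Z i) w" and ?Z = "Z(i := w)"
  have "\<bar>\<phi> (D j Z) (D' j Z) - \<phi> (D j ?Z) (D' j ?Z)\<bar> \<le>
      4 * ((\<Sum>u\<leftarrow>?U. touch u j Z) + (\<Sum>u\<leftarrow>?U. touch u j ?Z))" if j: "j < n" for j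
  proof (cases "j \<noteq> i \<and> fst (Z j) \<notin> set ?U \<and> snd (Z j) \<notin> set ?U")
    case True
    then show ?thesis
      using D_upd_other[OF Z Zi j] by (auto intro!: add_nonneg_nonneg sum_list_nonneg simp: touch_def)
  next
    \<comment> \<open>Ball \<open>i\<close> itself always falls here, because its old and new urns
      are in the list.\<close>
    case False
    then have "\<bar>\<phi> (D j Z) (D' j Z)\<bar> \<le> 4 * (\<Sum>u\<leftarrow>?U. touch u j Z)"
      "\<bar>\<phi> (D j ?Z) (D' j ?Z)\<bar> \<le> 4 * (\<Sum>u\<leftarrow>?U. touch u j ?Z)"
      by (intro phi_le_touch Z Zi j; force simp: urns_def)+
    from add_mono[OF this] show ?thesis
      unfolding distrib_left by (rule order.trans[OF abs_triangle_ineq4])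
  qed
  then have "\<bar>R \<phi> Z - R \<phi> ?Z\<bar> \<le> (\<Sum>j<n. 4 * ((\<Sum>u\<leftarrow>?U. touch u j Z) + (\<Sum>u\<leftarrow>?U. touch u j ?Z)))"
    unfolding R_def sum_subtractf[symmetric] by (intro order.trans[OF sum_abs] sum_mono) simp
  also have "\<dots> = 4 * (\<Sum>u\<leftarrow>?U. H u Z + H u ?Z)"
    by (simp add: H_def urns_def sum.distrib sum_distrib_left algebra_simps)
  finally show ?thesis .
qed

lemma R_upd_diff_power2:
  assumes Z: "Z \<in> P2" and Zi: "Z(i := w) \<in> P2"
  shows "(R \<phi> Z - R \<phi> (Z(i := w)))\<^sup>2 \<le>
    128 * ((\<Sum>u\<leftarrow>urns (Z i) w. (H u Z)\<^sup>2) + (\<Sum>u\<leftarrow>urns (Z i) w. (H u (Z(i := w)))\<^sup>2))"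
proof -
  let ?U = "urns (Z i) w" and ?Z = "Z(i := w)"
  let ?xs = "map (\<lambda>u. H u Z) ?U @ map (\<lambda>u. H u ?Z) ?U"
  have "\<bar>R \<phi> Z - R \<phi> ?Z\<bar> \<le> 4 * sum_list ?xs"
    using R_upd_diff[OF Z Zi] by (simp add: sum_list_addf)
  then have "(R \<phi> Z - R \<phi> ?Z)\<^sup>2 \<le> (4 * sum_list ?xs)\<^sup>2"
    using power_mono[of "\<bar>R \<phi> Z - R \<phi> ?Z\<bar>" _ 2] by (simp only: power2_abs abs_ge_zero)
  also have "\<dots> = 16 * (sum_list ?xs)\<^sup>2" by (simp only: power_mult_distrib) simp
  also have "\<dots> \<le> 16 * (real (length ?xs) * sum_list (map (\<lambda>x. x\<^sup>2) ?xs))"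
    by (intro mult_left_mono sum_list_power2_le) simp
  finally show ?thesis by (simp add: urns_def)
qed

text \<open>Efron-Stein with pairs of urns as coordinates. Summed over the resampled ball, its two
  old urns give the loads of \<open>u\<close> in both copies, and its two fresh independent uniform
  urns give \<open>2 * (n / m)\<close>.\<close>

lemma var_R_le:
  "var P2 (R \<phi>) \<le> 128 * avg P2 (\<lambda>Z. \<Sum>u<m. (real (cnt n (first_copy n Z) u) + real (cnt n (hybrid n n Z) u)
     + 2 * (real n / real m)) * (H u Z)\<^sup>2)"
proof -
  let ?V2 = "{..<m} \<times> {..<m}"
  let ?Q = "{..<n} \<rightarrow>\<^sub>E ?V2 \<times> ?V2"
  have V2: "finite ?V2" "?V2 \<noteq> {}" using m by (auto simp: lessThan_empty_iff)
  define f where "f = (\<lambda>i Z Z'. \<Sum>u\<leftarrow>urns (Z i) (Z' i). (H u Z)\<^sup>2)"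
  have K_avg: "avg ?Q (\<lambda>W. f i (first_copy n W) (hybrid n n W)) =
      avg P2 (\<lambda>Z. (H (fst (Z i)) Z)\<^sup>2 + (H (snd (Z i)) Z)\<^sup>2 + 2 / real m * (\<Sum>u<m. (H u Z)\<^sup>2))"
    if i: "i < n" for i
  proof -
    have "avg ?Q (\<lambda>W. f i (first_copy n W) (hybrid n n W)) = avg P2 (\<lambda>Z. avg P2 (f i Z))"
      by (rule avg_copies)
    also have "\<dots> = avg P2 (\<lambda>Z. (H (fst (Z i)) Z)\<^sup>2 + (H (snd (Z i)) Z)\<^sup>2 + 2 / real m * (\<Sum>u<m. (H u Z)\<^sup>2))"
    proof (rule avg_cong)
      fix Z
      have "avg P2 (\<lambda>Z'. (H (fst (Z' i)) Z)\<^sup>2) = (\<Sum>u<m. (H u Z)\<^sup>2) / real m"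
        using avg_first_copy[OF fin_V, of n "\<lambda>x. (H (x i) Z)\<^sup>2"] avg_coordinate[OF i] i
        by (simp add: first_copy_apply)
      moreover have "avg P2 (\<lambda>Z'. (H (snd (Z' i)) Z)\<^sup>2) = (\<Sum>u<m. (H u Z)\<^sup>2) / real m"
        using avg_hybrid_full[OF fin_V, of n "\<lambda>x. (H (x i) Z)\<^sup>2"] avg_coordinate[OF i] i
        by (simp add: hybrid_full_apply)
      ultimately show "avg P2 (f i Z) = (H (fst (Z i)) Z)\<^sup>2 + (H (snd (Z i)) Z)\<^sup>2 + 2 / real m * (\<Sum>u<m. (H u Z)\<^sup>2)"
        by (simp add: f_def urns_def avg_add avg_const[OF fin_P2])
    qed
    finally show ?thesis .
  qed
  have diff: "avg ?Q (\<lambda>W. (R \<phi> (first_copy n W) - R \<phi> (first_copy n (swap_on {i} W)))\<^sup>2)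
      \<le> 256 * avg ?Q (\<lambda>W. f i (first_copy n W) (hybrid n n W))" if i: "i < n" for i
  proof -
    let ?g = "\<lambda>W. f i (first_copy n W) (hybrid n n W)"
    have "avg ?Q (\<lambda>W. (R \<phi> (first_copy n W) - R \<phi> (first_copy n (swap_on {i} W)))\<^sup>2)
        \<le> avg ?Q (\<lambda>W. 128 * (?g W + ?g (swap_on {i} W)))"
    proof (rule avg_mono)
      fix W assume W: "W \<in> ?Q"
      let ?Z = "first_copy n W"
      have "swap_on {i} W \<in> ?Q" by (rule swap_on_mem) (use i W in auto)
      then have mem: "?Z \<in> P2" "?Z(i := snd (W i)) \<in> P2"
        using first_copy_mem[OF W] first_copy_mem[of "swap_on {i} W" n ?V2] i by (auto simp: first_copy_swap)
      \<comment> \<open>The terms after resampling are those before it in the swapped configuration,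
        so they have the same average; this doubles 128, and the 1/2 of Efron-Stein undoes
        it.\<close>
      have "?g W + ?g (swap_on {i} W) =
          (\<Sum>u\<leftarrow>urns (?Z i) (snd (W i)). (H u ?Z)\<^sup>2) + (\<Sum>u\<leftarrow>urns (?Z i) (snd (W i)). (H u (?Z(i := snd (W i))))\<^sup>2)"
      proof -
        have "swap_on {i} W i = prod.swap (W i)" by (simp add: swap_on_def)
        then show ?thesis
          using i by (simp add: f_def urns_def first_copy_swap hybrid_full_apply first_copy_apply)
      qed
      then show "(R \<phi> ?Z - R \<phi> (first_copy n (swap_on {i} W)))\<^sup>2 \<le> 128 * (?g W + ?g (swap_on {i} W))"
        using R_upd_diff_power2[OF mem] i by (simp add: first_copy_swap)
    qed
    also have "\<dots> = 256 * avg ?Q ?g"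
      unfolding avg_cmult avg_add using avg_swap_on[of "{i}" n ?V2 ?g] i by simp
    finally show ?thesis .
  qed
  have "var P2 (R \<phi>) \<le> (\<Sum>i<n. avg ?Q (\<lambda>W. (R \<phi> (first_copy n W) - R \<phi> (first_copy n (swap_on {i} W)))\<^sup>2)) / 2"
    by (rule efron_stein[OF V2])
  also have "\<dots> \<le> (\<Sum>i<n. 256 * avg ?Q (\<lambda>W. f i (first_copy n W) (hybrid n n W))) / 2"
    by (intro divide_right_mono sum_mono diff) auto
  also have "\<dots> = 128 * avg P2 (\<lambda>Z. \<Sum>i<n. (H (fst (Z i)) Z)\<^sup>2 + (H (snd (Z i)) Z)\<^sup>2 + 2 / real m * (\<Sum>u<m. (H u Z)\<^sup>2))"
    by (simp add: K_avg avg_sum sum_distrib_left[symmetric])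
  also have "avg P2 (\<lambda>Z. \<Sum>i<n. (H (fst (Z i)) Z)\<^sup>2 + (H (snd (Z i)) Z)\<^sup>2 + 2 / real m * (\<Sum>u<m. (H u Z)\<^sup>2))
     = avg P2 (\<lambda>Z. \<Sum>u<m. (real (cnt n (first_copy n Z) u) + real (cnt n (hybrid n n Z) u)
     + 2 * (real n / real m)) * (H u Z)\<^sup>2)"
  proof (rule avg_cong)
    fix Z assume Z: "Z \<in> P2"
    have "(\<Sum>i<n. (H (fst (Z i)) Z)\<^sup>2) = (\<Sum>u<m. real (cnt n (first_copy n Z) u) * (H u Z)\<^sup>2)"
      using sum_over_coordinates[OF first_copy_mem[OF Z], of "\<lambda>u. (H u Z)\<^sup>2"] by (simp add: first_copy_apply)
    moreover have "(\<Sum>i<n. (H (snd (Z i)) Z)\<^sup>2) = (\<Sum>u<m. real (cnt n (hybrid n n Z) u) * (H u Z)\<^sup>2)"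
      using sum_over_coordinates[OF hybrid_mem[OF order.refl Z], of "\<lambda>u. (H u Z)\<^sup>2"] by (simp add: hybrid_full_apply)
    moreover have "(\<Sum>i<n. 2 / real m * (\<Sum>u<m. (H u Z)\<^sup>2)) = (\<Sum>u<m. 2 * (real n / real m) * (H u Z)\<^sup>2)"
      by (simp add: sum_distrib_left mult_ac)
    ultimately show "(\<Sum>i<n. (H (fst (Z i)) Z)\<^sup>2 + (H (snd (Z i)) Z)\<^sup>2 + 2 / real m * (\<Sum>u<m. (H u Z)\<^sup>2)) =
      (\<Sum>u<m. (real (cnt n (first_copy n Z) u) + real (cnt n (hybrid n n Z) u) + 2 * (real n / real m)) * (H u Z)\<^sup>2)"
      by (simp only: sum.distrib distrib_right)
  qed
  finally show ?thesis .
qed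

end

text \<open>The states of a ball's own urn in which removing the ball matters: the ball is included
  in the count, hence no \<open>d - 1\<close>.\<close>

definition full :: "(nat \<Rightarrow> nat) \<Rightarrow> nat \<Rightarrow> real" where
  "full x v = of_bool (d \<le> cnt n x v \<and> cnt n x v \<le> d + 1)"

text \<open>The states of the replacement urn in which receiving the ball matters; the ball may or
  may not lie there already.\<close>

definition near :: "(nat \<Rightarrow> nat) \<Rightarrow> nat \<Rightarrow> real" where
  "near x v = of_bool (d - 1 \<le> cnt n x v \<and> cnt n x v \<le> d + 1)"

text \<open>Four cases: \<open>u\<close> is the old or the new urn of ball \<open>j\<close>, and the
  nonzero change stems from its old urn (\<open>full\<close>) or its new urn
  (\<open>near\<close>).\<close>

lemma H_le:
  assumes Z: "Z \<in> P2"
  defines "x \<equiv> first_copy n Z" and "y \<equiv> hybrid n n Z"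
  shows "H u Z \<le> real (cnt n x u) * full x u + real (cnt n y u) * near x u
    + (\<Sum>j<n. of_bool (x j = u) * near x (y j)) + (\<Sum>j<n. of_bool (y j = u) * full x (x j))"
proof -
  have "touch u j Z \<le> of_bool (x j = u) * full x u + of_bool (y j = u) * near x u
      + of_bool (x j = u) * near x (y j) + of_bool (y j = u) * full x (x j)" if j: "j < n" for j
  proof (cases "touch u j Z = 0")
    case False
    then have t: "u = x j \<or> u = y j" and "D j Z \<noteq> 0"
      using j by (auto simp: touch_def x_def y_def first_copy_apply hybrid_full_apply split: if_splits)
    then have "gain d (cnt_wo n j x (x j)) \<noteq> 0 \<or> gain d (cnt_wo n j x (y j)) \<noteq> 0"
      using D_eq[OF Z j] j by (auto simp: x_def y_def first_copy_apply hybrid_full_apply)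
    moreover have "c = d \<or> Suc c = d" if "gain d c \<noteq> 0" for c
      using that by (auto simp: gain_def)
    ultimately have "cnt_wo n j x (x j) = d \<or> Suc (cnt_wo n j x (x j)) = d
        \<or> cnt_wo n j x (y j) = d \<or> Suc (cnt_wo n j x (y j)) = d"
      by blast
    moreover have "full x (x j) = 1" if "cnt_wo n j x (x j) = d \<or> Suc (cnt_wo n j x (x j)) = d"
      using that cnt_eq_cnt_wo[OF j, of x "x j"] by (auto simp: full_def)
    moreover have "near x (y j) = 1" if "cnt_wo n j x (y j) = d \<or> Suc (cnt_wo n j x (y j)) = d"
      using that cnt_eq_cnt_wo[OF j, of x "y j"] by (auto simp: near_def of_bool_def)
    ultimately have "full x (x j) = 1 \<or> near x (y j) = 1"
      by blast
    moreover have "0 \<le> full x v" "0 \<le> near x v" for v by (auto simp: full_def near_def)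
    moreover have "touch u j Z \<le> 1" by (simp add: touch_def)
    ultimately show ?thesis using t by (smt (verit) mult_cancel_right1 of_bool_eq(2) mult_nonneg_nonneg of_bool_eq(1) mult_1)
  qed (auto simp: full_def near_def)
  then have "H u Z \<le> (\<Sum>j<n. of_bool (x j = u) * full x u + of_bool (y j = u) * near x u
      + of_bool (x j = u) * near x (y j) + of_bool (y j = u) * full x (x j))"
    unfolding H_def by (intro sum_mono) auto
  then show ?thesis
    unfolding sum.distrib sum_distrib_right[symmetric] cnt_eq_sum .
qed

end

section \<open>The Berry-Esseen bound\<close>

context occupancy
begin

section \<open>Mean numbers of critical urns and moments of loads\<close>

definition lam :: real where "lam = real n / real m"

definition avg_near :: real where
  "avg_near = binp n m (d - 1) + binp n m d + binp n m (d + 1)"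

definition avg_full :: real where
  "avg_full = binp n m d + binp n m (d + 1)"

lemma lam_nonneg: "0 \<le> lam" and m_lam: "real m * lam = real n" and m_pos: "0 < real m"
  using m by (auto simp: lam_def)

lemma avg_near_nonneg: "0 \<le> avg_near"
  using m by (simp add: avg_near_def binp_nonneg)

lemma near_nonneg: "0 \<le> near x v" and full_nonneg: "0 \<le> full x v"
  by (simp_all add: near_def full_def)

lemma avg_near_eq: "v < m \<Longrightarrow> avg P (\<lambda>x. near x v) = avg_near"
proof -
  assume v: "v < m"
  have "avg P (\<lambda>x. near x v) =
      avg P (\<lambda>x. of_bool (cnt n x v = d - 1) + of_bool (cnt n x v = d) + of_bool (cnt n x v = d + 1))"
  proof (rule avg_cong)
    fix x
    have "of_bool (d - 1 \<le> c \<and> c \<le> d + 1) = (of_bool (c = d - 1) + of_bool (c = d) + of_bool (c = d + 1) :: real)" for c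
      using d by (cases "c = d - 1"; cases "c = d"; cases "c = d + 1") (simp_all, linarith)
    then show "near x v = of_bool (cnt n x v = d - 1) + of_bool (cnt n x v = d) + of_bool (cnt n x v = d + 1)"
      by (simp only: near_def)
  qed
  then show ?thesis by (simp add: avg_add avg_cnt_eq v avg_near_def)
qed

lemma avg_full_eq: "v < m \<Longrightarrow> avg P (\<lambda>x. full x v) = avg_full"
proof -
  assume v: "v < m"
  have "avg P (\<lambda>x. full x v) = avg P (\<lambda>x. of_bool (cnt n x v = d) + of_bool (cnt n x v = d + 1))"
  proof (rule avg_cong)
    fix x
    have "of_bool (d \<le> c \<and> c \<le> d + 1) = (of_bool (c = d) + of_bool (c = d + 1) :: real)" for c
      by (cases "c = d"; cases "c = d + 1") auto
    then show "full x v = of_bool (cnt n x v = d) + of_bool (cnt n x v = d + 1)"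
      by (simp only: full_def)
  qed
  then show ?thesis by (simp add: avg_add avg_cnt_eq v avg_full_def)
qed

lemma binp_Suc_le_lam: "binp n m (d + 1) \<le> 2 * lam * binp n m d"
  using binp_Suc_le[OF m, of n d] m_pos by (simp add: lam_def field_simps)

lemma avg_full_le: "avg_full \<le> 2 * (1 + lam) * binp n m d"
  using binp_Suc_le_lam binp_nonneg[of m n d] m by (simp add: avg_full_def algebra_simps)

text \<open>For small \<open>lam\<close> the average of \<open>near\<close> is of order
  \<open>1 / lam\<close> times \<open>binp n m d\<close>, so only the product with
  \<open>lam\<close> is controlled by the mean.\<close>

lemma lam_avg_near_le: "lam * avg_near \<le> 2 * (real d)\<^sup>2 * (1 + lam)\<^sup>2 * binp n m d"
proof -
  have p: "0 \<le> binp n m d" using binp_nonneg m by simp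
  have "lam * binp n m (d - 1) \<le> (real d)\<^sup>2 * binp n m d"
    using binp_pred_le[of d n m] d dn m m_pos by (simp add: lam_def field_simps)
  moreover have "lam * binp n m (d + 1) \<le> lam * (2 * lam * binp n m d)"
    by (intro mult_left_mono binp_Suc_le_lam lam_nonneg)
  ultimately have "lam * avg_near \<le> ((real d)\<^sup>2 + lam + 2 * lam * lam) * binp n m d"
    by (simp add: avg_near_def algebra_simps)
  also have "\<dots> \<le> (2 * (real d)\<^sup>2 * (1 + lam)\<^sup>2) * binp n m d"
  proof (intro mult_right_mono p)
    have "1 \<le> (real d)\<^sup>2" using d by simp
    then have "1 * (lam + 2 * lam * lam) \<le> (real d)\<^sup>2 * (2 * lam * 2 + 2 * lam * lam)"
      using lam_nonneg by (intro mult_mono) auto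
    then have "(real d)\<^sup>2 + lam + 2 * lam * lam \<le>
        (real d)\<^sup>2 + (real d)\<^sup>2 * (2 * lam * 2 + 2 * lam * lam)"
      by simp
    also have "\<dots> \<le> (real d)\<^sup>2 * 2 + (real d)\<^sup>2 * (2 * lam * 2 + 2 * lam * lam)"
      by simp
    finally have "(real d)\<^sup>2 + lam + 2 * lam * lam \<le> (real d)\<^sup>2 * (2 + 2 * lam * 2 + 2 * lam * lam)"
      by (simp add: distrib_left)
    then show "(real d)\<^sup>2 + lam + 2 * lam * lam \<le> 2 * (real d)\<^sup>2 * (1 + lam)\<^sup>2"
      by (simp add: power2_eq_square algebra_simps)
  qed
  finally show ?thesis .
qed

lemma ex_other_urn: "\<exists>v<m. v \<noteq> u"
  using m by (intro exI[of _ "if u = 0 then 1 else 0"]) auto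

lemma pow_le_L: "(real k + 2 * lam) ^ i \<le> (real (max k 2) * (1 + lam)) ^ i"
proof (rule power_mono)
  have "2 * lam \<le> real (max k 2) * lam" using lam_nonneg by (intro mult_right_mono) auto
  then show "real k + 2 * lam \<le> real (max k 2) * (1 + lam)" by (simp add: distrib_left)
qed (use lam_nonneg in simp)

lemma cross_moments:
  assumes "u < m" "v < m" "u \<noteq> v" "\<And>r. 0 \<le> h r"
  shows "avg P (\<lambda>x. real (cnt n x u) * h (cnt n x v)) \<le> 2 * lam * avg P (\<lambda>x. h (cnt n x v))"
    and "avg P (\<lambda>x. real (cnt n x u) ^ 2 * h (cnt n x v)) \<le> 4 * lam * (1 + lam) * avg P (\<lambda>x. h (cnt n x v))"
    and "avg P (\<lambda>x. real (cnt n x u) ^ 3 * h (cnt n x v)) \<le> 18 * lam * (1 + lam)\<^sup>2 * avg P (\<lambda>x. h (cnt n x v))"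
proof -
  let ?A = "avg P (\<lambda>x. h (cnt n x v))"
  have A: "0 \<le> ?A" by (rule avg_nonneg) (simp add: assms)
  note mom = avg_moment_le[OF assms(1-3) m, of h n, folded lam_def]
  show "avg P (\<lambda>x. real (cnt n x u) * h (cnt n x v)) \<le> 2 * lam * ?A"
    using mom[of 0] assms(4) by simp
  have two: "2 * lam * (2 + 2 * lam) = 4 * lam * (1 + lam)" by (simp add: algebra_simps)
  have "2 * lam * (real 2 + 2 * lam) ^ 1 * ?A \<le> 2 * lam * (real (max 2 2) * (1 + lam)) ^ 1 * ?A"
    by (intro mult_right_mono mult_left_mono pow_le_L A) (use lam_nonneg in auto)
  then show "avg P (\<lambda>x. real (cnt n x u) ^ 2 * h (cnt n x v)) \<le> 4 * lam * (1 + lam) * ?A"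
    using mom[of 1] assms(4) by (simp add: numeral_2_eq_2 two)
  have "avg P (\<lambda>x. real (cnt n x u) ^ 3 * h (cnt n x v)) \<le> 2 * lam * (3 + 2 * lam)\<^sup>2 * ?A"
    using mom[of 2] assms(4) by simp
  also have "\<dots> \<le> 2 * lam * (3 * (1 + lam))\<^sup>2 * ?A"
    by (intro mult_right_mono mult_left_mono power_mono A) (use lam_nonneg in auto)
  also have "\<dots> = 18 * lam * (1 + lam)\<^sup>2 * ?A"
    unfolding power_mult_distrib by simp
  finally show "avg P (\<lambda>x. real (cnt n x u) ^ 3 * h (cnt n x v)) \<le> 18 * lam * (1 + lam)\<^sup>2 * ?A" .
qed

lemma moments:
  assumes u: "u < m"
  shows "avg P (\<lambda>x. real (cnt n x u)) \<le> 2 * lam"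
    and "avg P (\<lambda>x. real (cnt n x u) ^ 2) \<le> 4 * lam * (1 + lam)"
    and "avg P (\<lambda>x. real (cnt n x u) ^ 3) \<le> 18 * lam * (1 + lam)\<^sup>2"
proof -
  obtain v where "v < m" "v \<noteq> u" using ex_other_urn by blast
  then show "avg P (\<lambda>x. real (cnt n x u)) \<le> 2 * lam"
    "avg P (\<lambda>x. real (cnt n x u) ^ 2) \<le> 4 * lam * (1 + lam)"
    "avg P (\<lambda>x. real (cnt n x u) ^ 3) \<le> 18 * lam * (1 + lam)\<^sup>2"
    using cross_moments[of u v "\<lambda>_. 1"] u by (simp_all add: avg_const[OF fin_P])
qed

lemma prescribed_moments:
  assumes u: "u < m" and j: "j < n"
  shows "avg P (\<lambda>x. of_bool (x j = u) * real (cnt n x u)) \<le> 4 * (1 + lam) / real m"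
    and "avg P (\<lambda>x. of_bool (x j = u) * real (cnt n x u) ^ 2) \<le> 18 * (1 + lam)\<^sup>2 / real m"
proof -
  obtain v where v: "v < m" "v \<noteq> u" using ex_other_urn by blast
  note mom = avg_prescribed_moment_le[OF u v(1) v(2)[symmetric] m, of "\<lambda>_. 1" "{j}" n, folded lam_def]
  have "2 / real m * (real 2 + 2 * lam) ^ 1 \<le> 2 / real m * (real (max 2 2) * (1 + lam)) ^ 1"
    by (intro mult_left_mono pow_le_L) auto
  then show "avg P (\<lambda>x. of_bool (x j = u) * real (cnt n x u)) \<le> 4 * (1 + lam) / real m"
    using mom[of 1] j by (simp add: avg_const[OF fin_P])
  have "2 / real m * (real 3 + 2 * lam) ^ 2 \<le> 2 / real m * (real (max 3 2) * (1 + lam)) ^ 2"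
    by (intro mult_left_mono pow_le_L) auto
  moreover have "(3 + 3 * lam)\<^sup>2 = 9 * (1 + lam)\<^sup>2" by (simp add: power2_eq_square algebra_simps)
  ultimately show "avg P (\<lambda>x. of_bool (x j = u) * real (cnt n x u) ^ 2) \<le> 18 * (1 + lam)\<^sup>2 / real m"
    using mom[of 2] j by (simp add: avg_const[OF fin_P])
qed

lemma prescribed_moment_any:
  assumes u: "u < m" and v: "v < m" and j: "j < n"
  shows "avg P (\<lambda>x. of_bool (x j = v) * real (cnt n x u)) \<le> 4 * (1 + lam) / real m"
proof (cases "u = v")
  case True
  then show ?thesis using prescribed_moments[OF u j] by simp
next
  case False
  have "avg P (\<lambda>x. of_bool (x j = v) * real (cnt n x u)) \<le> 2 / real m * avg P (\<lambda>x. real (cnt n x u))"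
    using avg_prescribed_le[OF v u False[symmetric] m, of real "{j}" n] j by simp
  also have "\<dots> \<le> 2 / real m * (2 * lam)"
    by (intro mult_left_mono moments u) simp
  also have "\<dots> \<le> 4 * (1 + lam) / real m"
    using m_pos by (simp add: field_simps)
  finally show ?thesis .
qed

section \<open>The four contributions to the weighted second moment of \<open>H\<close>\<close>

lemma cnt_near_le: "real (cnt n x u) ^ k * near x u \<le> (real d + 1) ^ k * near x u"
  by (auto simp: near_def intro!: power_mono)

lemma cnt_full_le: "real (cnt n x u) ^ k * full x u \<le> (real d + 1) ^ k * full x u"
  by (auto simp: full_def intro!: power_mono)

text \<open>A \<open>full\<close> urn has bounded load in \<open>x\<close>; only the independent
  load in \<open>y\<close> and the fresh urns contribute \<open>lam\<close>.\<close>

lemma part_full: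
  "avg P (\<lambda>x. avg P (\<lambda>y. \<Sum>u<m. (real (cnt n x u) + real (cnt n y u) + 2 * lam) * ((real d + 1)\<^sup>2 * full x u)))
    \<le> (real d + 5) * (real d + 1)\<^sup>2 * (1 + lam) * (real m * avg_full)"
proof -
  have "avg P (\<lambda>y. \<Sum>u<m. (real (cnt n x u) + real (cnt n y u) + 2 * lam) * ((real d + 1)\<^sup>2 * full x u))
      \<le> (\<Sum>u<m. (real d + 5) * (real d + 1)\<^sup>2 * (1 + lam) * full x u)" for x
    unfolding avg_sum avg_cmult_right avg_add avg_const[OF fin_P]
  proof (rule sum_mono)
    fix u assume u: "u \<in> {..<m}"
    have "(real (cnt n x u) + avg P (\<lambda>y. real (cnt n y u)) + 2 * lam) * full x u
        \<le> real (cnt n x u) * full x u + 4 * lam * full x u"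
      using mult_right_mono[OF moments(1)[of u] full_nonneg[of x u]] u by (simp add: algebra_simps)
    also have "\<dots> \<le> (real d + 1) * full x u + 4 * lam * full x u"
      using cnt_full_le[of x u 1] by simp
    also have "\<dots> \<le> (real d + 5) * (1 + lam) * full x u"
      unfolding distrib_right[symmetric]
      by (intro mult_right_mono full_nonneg) (use lam_nonneg in \<open>simp add: algebra_simps\<close>)
    finally have "(real d + 1)\<^sup>2 * ((real (cnt n x u) + avg P (\<lambda>y. real (cnt n y u)) + 2 * lam) * full x u)
        \<le> (real d + 1)\<^sup>2 * ((real d + 5) * (1 + lam) * full x u)"
      by (rule mult_left_mono) simp
    then show "(real (cnt n x u) + avg P (\<lambda>y. real (cnt n y u)) + 2 * lam) * ((real d + 1)\<^sup>2 * full x u)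
        \<le> (real d + 5) * (real d + 1)\<^sup>2 * (1 + lam) * full x u"
      by (simp add: mult_ac)
  qed
  then have "avg P (\<lambda>x. avg P (\<lambda>y. \<Sum>u<m. (real (cnt n x u) + real (cnt n y u) + 2 * lam) * ((real d + 1)\<^sup>2 * full x u)))
      \<le> avg P (\<lambda>x. \<Sum>u<m. (real d + 5) * (real d + 1)\<^sup>2 * (1 + lam) * full x u)"
    by (intro avg_mono)
  also have "\<dots> = (real d + 5) * (real d + 1)\<^sup>2 * (1 + lam) * (real m * avg_full)"
    by (simp add: avg_sum avg_cmult avg_full_eq)
  finally show ?thesis .
qed

text \<open>Given \<open>x\<close>, the second and third moments of the independent load in
  \<open>y\<close> supply the factor \<open>lam\<close> that \<open>avg_near\<close>
  requires.\<close>

lemma part_near: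
  "avg P (\<lambda>x. avg P (\<lambda>y. \<Sum>u<m. (real (cnt n x u) + real (cnt n y u) + 2 * lam) * (real (cnt n y u) ^ 2 * near x u)))
    \<le> (4 * real d + 30) * (1 + lam)\<^sup>2 * (real m * (lam * avg_near))"
proof -
  have "avg P (\<lambda>y. \<Sum>u<m. (real (cnt n x u) + real (cnt n y u) + 2 * lam) * (real (cnt n y u) ^ 2 * near x u))
      \<le> (\<Sum>u<m. (4 * real d + 30) * (1 + lam)\<^sup>2 * lam * near x u)" for x
    unfolding avg_sum
  proof (rule sum_mono)
    fix u assume u: "u \<in> {..<m}"
    let ?M = "\<lambda>k. avg P (\<lambda>y. real (cnt n y u) ^ k)"
    have "avg P (\<lambda>y. (real (cnt n x u) + real (cnt n y u) + 2 * lam) * (real (cnt n y u) ^ 2 * near x u))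
      = avg P (\<lambda>y. (real (cnt n x u) * near x u + 2 * lam * near x u) * real (cnt n y u) ^ 2 + near x u * real (cnt n y u) ^ 3)"
      by (rule avg_cong) (simp add: power2_eq_square power3_eq_cube algebra_simps)
    also have "\<dots> = (real (cnt n x u) * near x u + 2 * lam * near x u) * ?M 2 + near x u * ?M 3"
      unfolding avg_add avg_cmult ..
    also have "\<dots> \<le> ((real d + 1) * near x u + 2 * lam * near x u) * (4 * lam * (1 + lam)) + near x u * (18 * lam * (1 + lam)\<^sup>2)"
    proof (rule add_mono)
      have u': "u < m" using u by simp
      show "(real (cnt n x u) * near x u + 2 * lam * near x u) * ?M 2
          \<le> ((real d + 1) * near x u + 2 * lam * near x u) * (4 * lam * (1 + lam))"
      proof (rule mult_mono)
        show "real (cnt n x u) * near x u + 2 * lam * near x u \<le> (real d + 1) * near x u + 2 * lam * near x u"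
          using cnt_near_le[of x u 1] by simp
        show "0 \<le> (real d + 1) * near x u + 2 * lam * near x u"
          using lam_nonneg near_nonneg[of x u] by simp
        show "0 \<le> ?M 2" by (rule avg_nonneg) simp
      qed (rule moments(2)[OF u'])
      show "near x u * ?M 3 \<le> near x u * (18 * lam * (1 + lam)\<^sup>2)"
        by (rule mult_left_mono[OF moments(3)[OF u'] near_nonneg])
    qed
    also have "\<dots> = (4 * (real d + 1 + 2 * lam) + 18 * (1 + lam)) * ((1 + lam) * lam * near x u)"
      by (simp add: power2_eq_square algebra_simps)
    also have "\<dots> \<le> ((4 * real d + 30) * (1 + lam)) * ((1 + lam) * lam * near x u)"
      by (intro mult_right_mono) (use lam_nonneg near_nonneg[of x u] in \<open>simp_all add: algebra_simps\<close>)
    also have "\<dots> = (4 * real d + 30) * (1 + lam)\<^sup>2 * lam * near x u"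
      by (simp add: power2_eq_square mult_ac)
    finally show "avg P (\<lambda>y. (real (cnt n x u) + real (cnt n y u) + 2 * lam) * (real (cnt n y u) ^ 2 * near x u))
      \<le> (4 * real d + 30) * (1 + lam)\<^sup>2 * lam * near x u" .
  qed
  then have "avg P (\<lambda>x. avg P (\<lambda>y. \<Sum>u<m. (real (cnt n x u) + real (cnt n y u) + 2 * lam) * (real (cnt n y u) ^ 2 * near x u)))
      \<le> avg P (\<lambda>x. \<Sum>u<m. (4 * real d + 30) * (1 + lam)\<^sup>2 * lam * near x u)"
    by (intro avg_mono)
  also have "\<dots> = (4 * real d + 30) * (1 + lam)\<^sup>2 * (real m * (lam * avg_near))"
    by (simp add: avg_sum avg_cmult avg_near_eq)
  finally show ?thesis .
qed

text \<open>Given \<open>x\<close>, the replacement urn is uniform, so \<open>near x (y j)\<close>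
  averages to the proportion \<open>S x\<close> of near urns. This leaves a double sum over urns
  \<open>u\<close> and \<open>v\<close>: cross moments give \<open>lam\<close> off the
  diagonal.\<close>

lemma part_source:
  "avg P (\<lambda>x. avg P (\<lambda>y. \<Sum>u<m. (real (cnt n x u) + real (cnt n y u) + 2 * lam) *
      (real (cnt n x u) * (\<Sum>j<n. of_bool (x j = u) * near x (y j)))))
    \<le> (42 + (real d + 1)\<^sup>2 * (real d + 7)) * (1 + lam)\<^sup>2 * (real m * (lam * avg_near))"
proof -
  define S where "S = (\<lambda>x. (\<Sum>v<m. near x v) / real m)"
  have S: "0 \<le> S x" for x by (simp add: S_def sum_nonneg near_nonneg)
  have y_avg: "avg P (\<lambda>y. \<Sum>u<m. (real (cnt n x u) + real (cnt n y u) + 2 * lam) *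
      (real (cnt n x u) * (\<Sum>j<n. of_bool (x j = u) * near x (y j))))
     \<le> (\<Sum>u<m. real (cnt n x u) ^ 2 * (real (cnt n x u) + 6 * (1 + lam)) * S x)" for x
    unfolding avg_sum
  proof (rule sum_mono)
    fix u assume u: "u \<in> {..<m}"
    let ?a = "real (cnt n x u)"
    have one: "avg P (\<lambda>y. (?a + real (cnt n y u) + 2 * lam) * near x (y j)) \<le> (?a + 6 * (1 + lam)) * S x"
      if j: "j < n" for j
    proof -
      have "avg P (\<lambda>y. real (cnt n y u) * near x (y j)) =
          avg P (\<lambda>y. \<Sum>v<m. near x v * (of_bool (y j = v) * real (cnt n y u)))"
      proof (rule avg_cong)
        fix y assume "y \<in> P"
        then have "y j < m" using j by auto
        then have "near x (y j) = (\<Sum>v<m. of_bool (y j = v) * near x v)"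
          by (simp only: sum_of_bool_mult_delta)
        then show "real (cnt n y u) * near x (y j) = (\<Sum>v<m. near x v * (of_bool (y j = v) * real (cnt n y u)))"
          by (simp only: sum_distrib_left) (simp only: mult_ac)
      qed
      also have "\<dots> \<le> (\<Sum>v<m. near x v * (4 * (1 + lam) / real m))"
        unfolding avg_sum avg_cmult
        by (intro sum_mono mult_left_mono prescribed_moment_any near_nonneg) (use u j in auto)
      also have "\<dots> = 4 * (1 + lam) * S x"
        unfolding S_def sum_distrib_right[symmetric] by simp
      finally have b: "avg P (\<lambda>y. real (cnt n y u) * near x (y j)) \<le> 4 * (1 + lam) * S x" .
      have "avg P (\<lambda>y. (?a + real (cnt n y u) + 2 * lam) * near x (y j))
          = avg P (\<lambda>y. (?a + 2 * lam) * near x (y j) + real (cnt n y u) * near x (y j))"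
        by (rule avg_cong) (simp add: algebra_simps)
      also have "\<dots> = (?a + 2 * lam) * S x + avg P (\<lambda>y. real (cnt n y u) * near x (y j))"
        unfolding avg_add avg_cmult using avg_coordinate[OF j, of m "near x"] by (simp add: S_def)
      also have "\<dots> \<le> (?a + 2 * lam) * S x + 4 * (1 + lam) * S x" using b by simp
      also have "\<dots> \<le> (?a + 6 * (1 + lam)) * S x"
        unfolding distrib_right[symmetric] by (intro mult_right_mono S) simp
      finally show ?thesis .
    qed
    have "avg P (\<lambda>y. (?a + real (cnt n y u) + 2 * lam) * (?a * (\<Sum>j<n. of_bool (x j = u) * near x (y j))))
      = avg P (\<lambda>y. \<Sum>j<n. ?a * of_bool (x j = u) * ((?a + real (cnt n y u) + 2 * lam) * near x (y j)))"
      by (rule avg_cong) (simp only: sum_distrib_left mult_ac)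
    also have "\<dots> \<le> (\<Sum>j<n. ?a * of_bool (x j = u) * ((?a + 6 * (1 + lam)) * S x))"
      unfolding avg_sum avg_cmult by (intro sum_mono mult_left_mono one) auto
    also have "\<dots> = ?a * (\<Sum>j<n. of_bool (x j = u)) * ((?a + 6 * (1 + lam)) * S x)"
      by (simp only: sum_distrib_left[symmetric] sum_distrib_right[symmetric])
    also have "\<dots> = ?a ^ 2 * (?a + 6 * (1 + lam)) * S x"
      unfolding cnt_eq_sum[symmetric] by (simp add: power2_eq_square)
    finally show "avg P (\<lambda>y. (?a + real (cnt n y u) + 2 * lam) * (?a * (\<Sum>j<n. of_bool (x j = u) * near x (y j))))
      \<le> ?a ^ 2 * (?a + 6 * (1 + lam)) * S x" .
  qed
  let ?w = "\<lambda>x u. real (cnt n x u) ^ 3 + 6 * (1 + lam) * real (cnt n x u) ^ 2"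
  let ?far = "42 * lam * (1 + lam)\<^sup>2 * avg_near"
  let ?diag = "(real d + 1)\<^sup>2 * (real d + 7) * (1 + lam) * avg_near"
  have pair: "avg P (\<lambda>x. ?w x u * near x v) \<le> ?far + of_bool (u = v) * ?diag"
    if u: "u < m" and v: "v < m" for u v
  proof (cases "u = v")
    case True
    have "?w x u * near x v \<le> (real d + 1)\<^sup>2 * (real d + 7) * (1 + lam) * near x v" for x
    proof -
      have "?w x u * near x v = real (cnt n x u) ^ 3 * near x u + 6 * (1 + lam) * (real (cnt n x u) ^ 2 * near x u)"
        using True by (simp add: algebra_simps)
      also have "\<dots> \<le> (real d + 1) ^ 3 * near x u + 6 * (1 + lam) * ((real d + 1) ^ 2 * near x u)"
        by (intro add_mono mult_left_mono cnt_near_le) (use lam_nonneg in auto)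
      also have "\<dots> = (real d + 1)\<^sup>2 * (real d + 1 + 6 * (1 + lam)) * near x u"
        by (simp add: power3_eq_cube power2_eq_square algebra_simps)
      also have "\<dots> \<le> (real d + 1)\<^sup>2 * ((real d + 7) * (1 + lam)) * near x u"
        by (intro mult_right_mono mult_left_mono near_nonneg) (use lam_nonneg in \<open>auto simp: algebra_simps\<close>)
      finally show ?thesis using True by (simp add: mult.assoc)
    qed
    then have "avg P (\<lambda>x. ?w x u * near x v) \<le> avg P (\<lambda>x. (real d + 1)\<^sup>2 * (real d + 7) * (1 + lam) * near x v)"
      by (intro avg_mono)
    also have "\<dots> = ?diag" by (simp add: avg_cmult avg_near_eq v)
    also have "\<dots> \<le> ?far + of_bool (u = v) * ?diag"
      using True lam_nonneg avg_near_nonneg by simp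
    finally show ?thesis .
  next
    case False
    define h where "h = (\<lambda>r. of_bool (d - 1 \<le> r \<and> r \<le> d + 1) :: real)"
    have h: "near x v = h (cnt n x v)" "0 \<le> h r" for x r by (simp_all add: near_def h_def)
    have "avg P (\<lambda>x. ?w x u * near x v) =
        avg P (\<lambda>x. real (cnt n x u) ^ 3 * near x v) + 6 * (1 + lam) * avg P (\<lambda>x. real (cnt n x u) ^ 2 * near x v)"
      by (simp add: distrib_right avg_add mult.assoc avg_cmult)
    also have "\<dots> \<le> 18 * lam * (1 + lam)\<^sup>2 * avg_near + 6 * (1 + lam) * (4 * lam * (1 + lam) * avg_near)"
      unfolding avg_near_eq[OF v, symmetric] unfolding h(1)
      by (intro add_mono mult_left_mono cross_moments u v False h) (use lam_nonneg in auto)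
    also have "\<dots> = ?far" by (simp add: power2_eq_square algebra_simps)
    finally show ?thesis using False by simp
  qed
  have "avg P (\<lambda>x. \<Sum>u<m. real (cnt n x u) ^ 2 * (real (cnt n x u) + 6 * (1 + lam)) * S x)
     = avg P (\<lambda>x. (\<Sum>u<m. \<Sum>v<m. ?w x u * near x v) * (1 / real m))"
  proof (rule avg_cong)
    fix x
    have "(\<Sum>u<m. \<Sum>v<m. ?w x u * near x v) * (1 / real m) = (\<Sum>u<m. ?w x u * S x)"
      unfolding S_def sum_distrib_left[symmetric] sum_distrib_right by (rule sum.cong) simp_all
    also have "\<dots> = (\<Sum>u<m. real (cnt n x u) ^ 2 * (real (cnt n x u) + 6 * (1 + lam)) * S x)"
      by (rule sum.cong) (simp_all add: power3_eq_cube power2_eq_square algebra_simps)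
    finally show "(\<Sum>u<m. real (cnt n x u) ^ 2 * (real (cnt n x u) + 6 * (1 + lam)) * S x)
      = (\<Sum>u<m. \<Sum>v<m. ?w x u * near x v) * (1 / real m)" by simp
  qed
  also have "\<dots> \<le> (\<Sum>u<m. \<Sum>v<m. ?far + of_bool (u = v) * ?diag) * (1 / real m)"
    unfolding avg_cmult_right avg_sum by (intro mult_right_mono sum_mono pair) auto
  also have "\<dots> = real m * ?far + ?diag"
  proof -
    have "(\<Sum>v<m. ?far + of_bool (u = v) * ?diag) = real m * ?far + ?diag" if "u < m" for u
      unfolding sum.distrib sum_of_bool_mult_delta[OF that] by simp
    then have "(\<Sum>u<m. \<Sum>v<m. ?far + of_bool (u = v) * ?diag) = real m * (real m * ?far + ?diag)"
      by simp
    then show ?thesis using m_pos by simp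
  qed
  \<comment> \<open>The diagonal lacks a factor \<open>lam\<close>, but it has only \<open>m\<close>
    entries against the \<open>1 / m\<close> in \<open>S\<close>; \<open>1 <= n = m * lam\<close>
    supplies the factor.\<close>
  also have "\<dots> \<le> real m * ?far + (real d + 1)\<^sup>2 * (real d + 7) * (1 + lam)\<^sup>2 * (real m * (lam * avg_near))"
  proof (intro add_left_mono)
    have "1 \<le> real m * lam" using dn d by (simp add: m_lam)
    then have "1 * avg_near \<le> (real m * lam) * avg_near"
      by (intro mult_right_mono avg_near_nonneg)
    moreover have "(1 + lam) \<le> (1 + lam)\<^sup>2"
      using lam_nonneg by (simp add: power2_eq_square)
    ultimately have "(1 + lam) * avg_near \<le> (1 + lam)\<^sup>2 * (real m * (lam * avg_near))"
      using lam_nonneg avg_near_nonneg by (intro mult_mono) (auto simp: mult.assoc)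
    then have "((real d + 1)\<^sup>2 * (real d + 7)) * ((1 + lam) * avg_near)
        \<le> ((real d + 1)\<^sup>2 * (real d + 7)) * ((1 + lam)\<^sup>2 * (real m * (lam * avg_near)))"
      by (rule mult_left_mono) simp
    then show "?diag \<le> (real d + 1)\<^sup>2 * (real d + 7) * (1 + lam)\<^sup>2 * (real m * (lam * avg_near))"
      by (simp only: mult.assoc)
  qed
  also have "\<dots> = (42 + (real d + 1)\<^sup>2 * (real d + 7)) * (1 + lam)\<^sup>2 * (real m * (lam * avg_near))"
    by (simp add: algebra_simps)
  finally have "avg P (\<lambda>x. \<Sum>u<m. real (cnt n x u) ^ 2 * (real (cnt n x u) + 6 * (1 + lam)) * S x)
    \<le> (42 + (real d + 1)\<^sup>2 * (real d + 7)) * (1 + lam)\<^sup>2 * (real m * (lam * avg_near))" .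
  then show ?thesis
    by (rule order.trans[rotated]) (rule avg_mono, rule y_avg)
qed

text \<open>Each event \<open>y j = u\<close> costs \<open>1 / m\<close>, and the loads of
  \<open>x\<close> sum to \<open>m * lam\<close>, so the sum over \<open>u\<close> stays of order
  \<open>(1 + lam)^2\<close>. The old urn is \<open>full\<close>, so no extra factor
  \<open>lam\<close> is needed.\<close>

lemma part_target:
  "avg P (\<lambda>x. avg P (\<lambda>y. \<Sum>u<m. (real (cnt n x u) + real (cnt n y u) + 2 * lam) *
      (real (cnt n y u) * (\<Sum>j<n. of_bool (y j = u) * full x (x j)))))
    \<le> 30 * (real d + 1) * (1 + lam)\<^sup>2 * (real m * avg_full)"
proof -
  have y_avg: "avg P (\<lambda>y. \<Sum>u<m. (real (cnt n x u) + real (cnt n y u) + 2 * lam) *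
      (real (cnt n y u) * (\<Sum>j<n. of_bool (y j = u) * full x (x j))))
     \<le> (\<Sum>v<m. 30 * (real d + 1) * (1 + lam)\<^sup>2 * full x v)" if x: "x \<in> P" for x
  proof -
    let ?a = "\<lambda>u. real (cnt n x u)"
    have one: "avg P (\<lambda>y. (?a u + real (cnt n y u) + 2 * lam) * (real (cnt n y u) * of_bool (y j = u)))
       \<le> ((?a u + 2 * lam) * (4 * (1 + lam)) + 18 * (1 + lam)\<^sup>2) / real m"
      if u: "u < m" and j: "j < n" for u j
    proof -
      have "avg P (\<lambda>y. (?a u + real (cnt n y u) + 2 * lam) * (real (cnt n y u) * of_bool (y j = u)))
        = avg P (\<lambda>y. (?a u + 2 * lam) * (of_bool (y j = u) * real (cnt n y u)) + of_bool (y j = u) * real (cnt n y u) ^ 2)"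
        by (rule avg_cong) (simp add: power2_eq_square algebra_simps)
      also have "\<dots> \<le> (?a u + 2 * lam) * (4 * (1 + lam) / real m) + 18 * (1 + lam)\<^sup>2 / real m"
        unfolding avg_add avg_cmult
        by (intro add_mono mult_left_mono prescribed_moments u j) (use lam_nonneg in auto)
      finally show ?thesis by (simp only: add_divide_distrib times_divide_eq_right)
    qed
    have "avg P (\<lambda>y. \<Sum>u<m. (?a u + real (cnt n y u) + 2 * lam) * (real (cnt n y u) * (\<Sum>j<n. of_bool (y j = u) * full x (x j))))
      = avg P (\<lambda>y. \<Sum>u<m. \<Sum>j<n. full x (x j) * ((?a u + real (cnt n y u) + 2 * lam) * (real (cnt n y u) * of_bool (y j = u))))"
      by (intro avg_cong sum.cong refl) (simp only: sum_distrib_left mult_ac)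
    also have "\<dots> \<le> (\<Sum>u<m. \<Sum>j<n. full x (x j) * (((?a u + 2 * lam) * (4 * (1 + lam)) + 18 * (1 + lam)\<^sup>2) / real m))"
      unfolding avg_sum avg_cmult by (intro sum_mono mult_left_mono one full_nonneg) auto
    also have "\<dots> = (\<Sum>j<n. full x (x j)) * ((\<Sum>u<m. (?a u + 2 * lam) * (4 * (1 + lam)) + 18 * (1 + lam)\<^sup>2) / real m)"
      by (simp only: sum_distrib_left[symmetric] sum_distrib_right[symmetric] sum_divide_distrib[symmetric])
    also have "(\<Sum>u<m. (?a u + 2 * lam) * (4 * (1 + lam)) + 18 * (1 + lam)\<^sup>2) / real m = 12 * lam * (1 + lam) + 18 * (1 + lam)\<^sup>2"
    proof -
      have "(\<Sum>u<m. (?a u + 2 * lam) * (4 * (1 + lam)) + 18 * (1 + lam)\<^sup>2) =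
          real m * (12 * lam * (1 + lam) + 18 * (1 + lam)\<^sup>2)"
        unfolding sum.distrib sum_distrib_right[symmetric] sum_cnt[OF x] m_lam[symmetric]
        by (simp add: algebra_simps)
      then show ?thesis using m_pos by simp
    qed
    also have "(\<Sum>j<n. full x (x j)) = (\<Sum>v<m. ?a v * full x v)"
      by (rule sum_over_coordinates[OF x])
    also have "(\<Sum>v<m. ?a v * full x v) * (12 * lam * (1 + lam) + 18 * (1 + lam)\<^sup>2)
       \<le> (\<Sum>v<m. (real d + 1) * full x v) * (30 * (1 + lam)\<^sup>2)"
    proof (rule mult_mono)
      show "(\<Sum>v<m. ?a v * full x v) \<le> (\<Sum>v<m. (real d + 1) * full x v)"
        by (rule sum_mono) (use cnt_full_le[of x _ 1] in simp)
      show "12 * lam * (1 + lam) + 18 * (1 + lam)\<^sup>2 \<le> 30 * (1 + lam)\<^sup>2"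
        using lam_nonneg by (simp add: power2_eq_square algebra_simps)
      show "0 \<le> (\<Sum>v<m. (real d + 1) * full x v)"
        by (intro sum_nonneg mult_nonneg_nonneg full_nonneg) simp
    qed (use lam_nonneg in simp)
    also have "\<dots> = (\<Sum>v<m. 30 * (real d + 1) * (1 + lam)\<^sup>2 * full x v)"
      unfolding sum_distrib_right by (rule sum.cong) (simp_all only: mult_ac)
    finally show ?thesis .
  qed
  then have "avg P (\<lambda>x. avg P (\<lambda>y. \<Sum>u<m. (real (cnt n x u) + real (cnt n y u) + 2 * lam) *
      (real (cnt n y u) * (\<Sum>j<n. of_bool (y j = u) * full x (x j)))))
    \<le> avg P (\<lambda>x. \<Sum>v<m. 30 * (real d + 1) * (1 + lam)\<^sup>2 * full x v)"
    by (intro avg_mono)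
  also have "\<dots> = 30 * (real d + 1) * (1 + lam)\<^sup>2 * (real m * avg_full)"
    by (simp add: avg_sum avg_cmult avg_full_eq)
  finally show ?thesis .
qed

text \<open>Cauchy-Schwarz for four terms. The two sums over \<open>j\<close> are bounded by the
  load of \<open>u\<close>, so one factor of each square is replaced by that load and no double sum
  over balls arises.\<close>

lemma H_power2_le:
  assumes Z: "Z \<in> P2"
  defines "x \<equiv> first_copy n Z" and "y \<equiv> hybrid n n Z"
  shows "(H u Z)\<^sup>2 \<le> 4 * ((real d + 1)\<^sup>2 * full x u + real (cnt n y u) ^ 2 * near x u
    + real (cnt n x u) * (\<Sum>j<n. of_bool (x j = u) * near x (y j))
    + real (cnt n y u) * (\<Sum>j<n. of_bool (y j = u) * full x (x j)))"
proof -
  let ?a = "real (cnt n x u)" and ?b = "real (cnt n y u)"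
  let ?A3 = "\<Sum>j<n. of_bool (x j = u) * near x (y j)" and ?A4 = "\<Sum>j<n. of_bool (y j = u) * full x (x j)"
  have "0 \<le> H u Z" by (simp add: H_def touch_def sum_nonneg)
  then have "(H u Z)\<^sup>2 \<le> (sum_list [?a * full x u, ?b * near x u, ?A3, ?A4])\<^sup>2"
    using H_le[OF Z, of u] unfolding x_def y_def by (intro power_mono) (simp_all add: add_ac)
  also have "\<dots> \<le> 4 * ((?a * full x u)\<^sup>2 + (?b * near x u)\<^sup>2 + ?A3\<^sup>2 + ?A4\<^sup>2)"
    using sum_list_power2_le[of "[?a * full x u, ?b * near x u, ?A3, ?A4]"] by (simp add: add_ac)
  also have "\<dots> \<le> 4 * ((real d + 1)\<^sup>2 * full x u + ?b ^ 2 * near x u + ?a * ?A3 + ?b * ?A4)"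
  proof (intro mult_left_mono add_mono)
    have "(?a * full x u)\<^sup>2 = ?a ^ 2 * full x u"
      by (simp add: power_mult_distrib full_def)
    then show "(?a * full x u)\<^sup>2 \<le> (real d + 1)\<^sup>2 * full x u"
      using cnt_full_le[of x u 2] by simp
    show "(?b * near x u)\<^sup>2 \<le> ?b ^ 2 * near x u"
      by (simp add: power_mult_distrib near_def)
    have "?A3 \<le> ?a"
      unfolding cnt_eq_sum by (intro sum_mono) (simp add: near_def)
    then show "?A3\<^sup>2 \<le> ?a * ?A3"
      unfolding power2_eq_square by (intro mult_right_mono) (auto intro!: sum_nonneg simp: near_nonneg)
    have "?A4 \<le> ?b"
      unfolding cnt_eq_sum by (intro sum_mono) (simp add: full_def)
    then show "?A4\<^sup>2 \<le> ?b * ?A4"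
      unfolding power2_eq_square by (intro mult_right_mono) (auto intro!: sum_nonneg simp: full_nonneg)
  qed simp
  finally show ?thesis .
qed

text \<open>Collects the four parts: the \<open>full\<close> parts carry the 2 of
  \<open>avg_full_le\<close>, the \<open>near\<close> parts the \<open>2 * d^2\<close> of
  \<open>lam_avg_near_le\<close>, and \<open>72 = 30 + 42\<close>.\<close>

definition K :: real where
  "K = 2 * (real d + 5) * (real d + 1)\<^sup>2
     + 2 * (real d)\<^sup>2 * (4 * real d + 72 + (real d + 1)\<^sup>2 * (real d + 7)) + 60 * (real d + 1)"

lemma avg_weighted_H_le:
  "avg P2 (\<lambda>Z. \<Sum>u<m. (real (cnt n (first_copy n Z) u) + real (cnt n (hybrid n n Z) u)
     + 2 * (real n / real m)) * (H u Z)\<^sup>2) \<le> 4 * K * (1 + lam) ^ 4 * (real m * binp n m d)"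
proof -
  let ?w = "\<lambda>x y u. real (cnt n x u) + real (cnt n y u) + 2 * lam"
  let ?t1 = "\<lambda>x y u. (real d + 1)\<^sup>2 * full x u"
  let ?t2 = "\<lambda>x y u. real (cnt n y u) ^ 2 * near x u"
  let ?t3 = "\<lambda>x y u. real (cnt n x u) * (\<Sum>j<n. of_bool (x j = u) * near x (y j))"
  let ?t4 = "\<lambda>x y u. real (cnt n y u) * (\<Sum>j<n. of_bool (y j = u) * full x (x j))"
  let ?p = "real m * binp n m d" and ?L = "1 + lam"
  define f where "f = (\<lambda>x y. \<Sum>u<m. ?w x y u * (4 * (?t1 x y u + ?t2 x y u + ?t3 x y u + ?t4 x y u)))"
  have p: "0 \<le> ?p" using binp_nonneg m by simp
  have L: "1 \<le> ?L" using lam_nonneg by simp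
  have "avg P2 (\<lambda>Z. \<Sum>u<m. ?w (first_copy n Z) (hybrid n n Z) u * (H u Z)\<^sup>2)
      \<le> avg P2 (\<lambda>Z. f (first_copy n Z) (hybrid n n Z))"
    unfolding f_def
    by (intro avg_mono sum_mono mult_left_mono H_power2_le) (use lam_nonneg in auto)
  also have "\<dots> = avg P (\<lambda>x. avg P (f x))"
    by (rule avg_copies)
  also have "\<dots> = 4 * (avg P (\<lambda>x. avg P (\<lambda>y. \<Sum>u<m. ?w x y u * ?t1 x y u)) + avg P (\<lambda>x. avg P (\<lambda>y. \<Sum>u<m. ?w x y u * ?t2 x y u))
      + avg P (\<lambda>x. avg P (\<lambda>y. \<Sum>u<m. ?w x y u * ?t3 x y u)) + avg P (\<lambda>x. avg P (\<lambda>y. \<Sum>u<m. ?w x y u * ?t4 x y u)))"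
  proof -
    have "f x y = 4 * ((\<Sum>u<m. ?w x y u * ?t1 x y u) + (\<Sum>u<m. ?w x y u * ?t2 x y u)
        + (\<Sum>u<m. ?w x y u * ?t3 x y u) + (\<Sum>u<m. ?w x y u * ?t4 x y u))" for x y
      unfolding f_def sum.distrib[symmetric] sum_distrib_left[of 4]
      by (rule sum.cong[OF refl]) (simp only: distrib_left mult.left_commute[of _ 4])
    then have "f = (\<lambda>x y. 4 * ((\<Sum>u<m. ?w x y u * ?t1 x y u) + (\<Sum>u<m. ?w x y u * ?t2 x y u)
        + (\<Sum>u<m. ?w x y u * ?t3 x y u) + (\<Sum>u<m. ?w x y u * ?t4 x y u)))"
      by (intro ext)
    then show ?thesis by (simp only: avg_add avg_cmult)
  qed
  also have "\<dots> \<le> 4 * ((real d + 5) * (real d + 1)\<^sup>2 * ?L * (real m * avg_full)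
      + (4 * real d + 30) * ?L\<^sup>2 * (real m * (lam * avg_near))
      + (42 + (real d + 1)\<^sup>2 * (real d + 7)) * ?L\<^sup>2 * (real m * (lam * avg_near))
      + 30 * (real d + 1) * ?L\<^sup>2 * (real m * avg_full))"
    by (intro mult_left_mono add_mono part_full part_near part_source part_target) simp
  also have "\<dots> = 4 * ((real d + 5) * (real d + 1)\<^sup>2 * (?L * (real m * avg_full))
      + (4 * real d + 72 + (real d + 1)\<^sup>2 * (real d + 7)) * (?L\<^sup>2 * (real m * (lam * avg_near)))
      + 30 * (real d + 1) * (?L\<^sup>2 * (real m * avg_full)))"
    by (simp add: algebra_simps)
  also have "\<dots> \<le> 4 * ((real d + 5) * (real d + 1)\<^sup>2 * (2 * (?L ^ 4 * ?p))
      + (4 * real d + 72 + (real d + 1)\<^sup>2 * (real d + 7)) * (2 * (real d)\<^sup>2 * (?L ^ 4 * ?p))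
      + 30 * (real d + 1) * (2 * (?L ^ 4 * ?p)))"
  proof (intro mult_left_mono add_mono)
    \<comment> \<open>Passing from \<open>avg_full\<close> to \<open>binp n m d\<close> costs one
      power of \<open>1 + lam\<close>, from \<open>lam * avg_near\<close> two; the latter, on top of
      a square, fixes the exponent 4.\<close>
    have full: "?L ^ k * (real m * avg_full) \<le> 2 * (?L ^ 4 * ?p)" if "Suc k \<le> 4" for k
    proof -
      have "?L ^ k * (real m * avg_full) \<le> ?L ^ k * (real m * (2 * ?L * binp n m d))"
        by (intro mult_left_mono avg_full_le) (use lam_nonneg in auto)
      also have "\<dots> = 2 * (?L ^ Suc k * ?p)" by simp
      also have "\<dots> \<le> 2 * (?L ^ 4 * ?p)"
        by (intro mult_left_mono mult_right_mono power_increasing that L p) simp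
      finally show ?thesis .
    qed
    show "?L * (real m * avg_full) \<le> 2 * (?L ^ 4 * ?p)" using full[of 1] by simp
    show "?L\<^sup>2 * (real m * avg_full) \<le> 2 * (?L ^ 4 * ?p)" using full[of 2] by simp
    have "?L\<^sup>2 * (real m * (lam * avg_near)) \<le> ?L\<^sup>2 * (real m * (2 * (real d)\<^sup>2 * ?L\<^sup>2 * binp n m d))"
      by (intro mult_left_mono lam_avg_near_le) auto
    also have "\<dots> = 2 * (real d)\<^sup>2 * (?L ^ 4 * ?p)"
      by (simp add: power2_eq_square power4_eq_xxxx mult_ac)
    finally show "?L\<^sup>2 * (real m * (lam * avg_near)) \<le> 2 * (real d)\<^sup>2 * (?L ^ 4 * ?p)" .
  qed simp_all
  also have "\<dots> = 4 * K * ?L ^ 4 * ?p"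
    by (simp add: K_def algebra_simps)
  finally show ?thesis by (simp only: lam_def)
qed

lemma var_pos: "0 < var P (occF n m d)"
proof -
  have "0 < real m * binp n m d" using binp_pos[OF dn m] m_pos by simp
  also have "\<dots> \<le> 24 * (real d + 1) * var P (occF n m d)" by (rule occ_var_ge[OF d m])
  finally show ?thesis by (simp add: zero_less_mult_iff)
qed

lemma var_functional_le:
  assumes "\<And>a b. \<bar>a\<bar> \<le> 2 \<Longrightarrow> \<bar>b\<bar> \<le> 2 \<Longrightarrow> \<bar>\<phi> a b\<bar> \<le> 4 * of_bool (a \<noteq> 0)"
  shows "sqrt (var P2 (R \<phi>)) \<le> sqrt (12288 * K * (real d + 1)) * (1 + lam)\<^sup>2 * sqrt (var P (occF n m d))"
proof -
  let ?v = "var P (occF n m d)"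
  have K: "0 \<le> K" by (simp add: K_def)
  have "var P2 (R \<phi>) \<le> 128 * (4 * K * (1 + lam) ^ 4 * (real m * binp n m d))"
    using var_R_le[of \<phi>, OF assms] avg_weighted_H_le by linarith
  also have "\<dots> \<le> 128 * (4 * K * (1 + lam) ^ 4 * (24 * (real d + 1) * ?v))"
    by (intro mult_left_mono occ_var_ge d m) (use K in auto)
  \<comment> \<open>\<open>12288 = 128 * 4 * 24\<close>, from Efron-Stein, the weighted bound on
    \<open>H\<close> and the variance lower bound.\<close>
  also have "\<dots> = 12288 * K * (real d + 1) * ((1 + lam)\<^sup>2)\<^sup>2 * ?v"
    by (simp add: mult_ac)
  finally have "sqrt (var P2 (R \<phi>)) \<le> sqrt (12288 * K * (real d + 1) * ((1 + lam)\<^sup>2)\<^sup>2 * ?v)"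
    by (rule real_sqrt_le_mono)
  moreover have "sqrt (c * ((1 + lam)\<^sup>2)\<^sup>2 * v) = sqrt c * (1 + lam)\<^sup>2 * sqrt v" for c v
    by (simp only: real_sqrt_mult real_sqrt_abs abs_power2)
  ultimately show ?thesis by (simp only:)
qed

lemma T_eq_R: "T = R (\<lambda>a b. a * b / 2)"
  by (simp add: fun_eq_iff T_def R_def sum_divide_distrib)

lemma T_abs_eq_R: "T_abs = R (\<lambda>a b. \<bar>b\<bar> * a)"
  by (simp add: fun_eq_iff T_abs_def R_def)

lemma berry_esseen:
  "\<bar>avg P (\<lambda>x. of_bool ((occF n m d x - avg P (occF n m d)) / sqrt (var P (occF n m d)) \<le> z)) - Phi z\<bar>
    \<le> 16 * sqrt (12288 * K * (real d + 1)) * (1 + lam ^ 3) / sqrt (var P (occF n m d))"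
proof -
  let ?v = "var P (occF n m d)" and ?c = "sqrt (12288 * K * (real d + 1))"
  have c: "0 \<le> ?c" by (simp add: K_def)
  have "sqrt (var P2 T) \<le> ?c * (1 + lam)\<^sup>2 * sqrt ?v"
    unfolding T_eq_R
  proof (rule var_functional_le)
    fix a b :: real assume "\<bar>a\<bar> \<le> 2" "\<bar>b\<bar> \<le> 2"
    then show "\<bar>a * b / 2\<bar> \<le> 4 * of_bool (a \<noteq> 0)"
      using mult_mono[of "\<bar>a\<bar>" 2 "\<bar>b\<bar>" 2] by (auto simp: abs_mult)
  qed
  moreover have "sqrt (var P2 T_abs) \<le> ?c * (1 + lam)\<^sup>2 * sqrt ?v"
    unfolding T_abs_eq_R
  proof (rule var_functional_le)
    fix a b :: real assume "\<bar>a\<bar> \<le> 2" "\<bar>b\<bar> \<le> 2"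
    then show "\<bar>\<bar>b\<bar> * a\<bar> \<le> 4 * of_bool (a \<noteq> 0)"
      using mult_mono[of "\<bar>b\<bar>" 2 "\<bar>a\<bar>" 2] by (auto simp: abs_mult)
  qed
  ultimately have "2 / ?v * (sqrt (var P2 T) + sqrt (var P2 T_abs)) \<le> 2 / ?v * (2 * (?c * (1 + lam)\<^sup>2 * sqrt ?v))"
    by (intro mult_left_mono) (use var_pos in auto)
  also have "\<dots> = 4 * ?c * (1 + lam)\<^sup>2 * (sqrt ?v / ?v)"
    by simp
  also have "sqrt ?v / ?v = 1 / sqrt ?v"
    using var_pos by (simp add: real_divide_square_eq field_simps)
  also have "4 * ?c * (1 + lam)\<^sup>2 * (1 / sqrt ?v) \<le> 4 * ?c * (4 * (1 + lam ^ 3)) * (1 / sqrt ?v)"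
  proof (intro mult_right_mono mult_left_mono)
    \<comment> \<open>Conversion to the normalisation in \<open>occ_r\<close>; it accounts for one
      of the two factors 4 in 16.\<close>
    show "(1 + lam)\<^sup>2 \<le> 4 * (1 + lam ^ 3)"
    proof (cases "lam \<le> 1")
      case True
      then have "(1 + lam)\<^sup>2 \<le> 2\<^sup>2" using lam_nonneg by (intro power_mono) auto
      also have "\<dots> \<le> 4 * (1 + lam ^ 3)" using lam_nonneg by simp
      finally show ?thesis .
    next
      case False
      then have "(1 + lam)\<^sup>2 \<le> (2 * lam)\<^sup>2" using lam_nonneg by (intro power_mono) auto
      also have "\<dots> = 4 * lam\<^sup>2" by simp
      also have "\<dots> \<le> 4 * lam ^ 3" using False by (intro mult_left_mono power_increasing) auto
      finally show ?thesis by simp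
    qed
  qed (use c var_pos in auto)
  also have "4 * ?c * (4 * (1 + lam ^ 3)) * (1 / sqrt ?v) = 16 * ?c * (1 + lam ^ 3) / sqrt ?v"
  proof -
    have "4 * c * (4 * x) * (1 / y) = 16 * c * x / y" for c x y :: real by simp
    then show ?thesis .
  qed
  finally show ?thesis
    by (rule order.trans[OF kolmogorov_bound[OF var_pos]])
qed

end

lemma occY_eq_occF: "occY n m d x = occF n m d x"
  by (simp add: occY_def occF_def cnt_def Int_def)

theorem theorem1p1:
  fixes d :: nat
  assumes "d \<ge> 2"
  shows "\<exists>C::real. \<forall>n m. n \<ge> d \<longrightarrow> m \<ge> 2 \<longrightarrow>
           (SUP z. \<bar>occ_cdf n m d z - Phi z\<bar>) \<le> C / occ_r n m d"
proof (intro exI allI impI)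
  fix n m :: nat
  assume nm: "d \<le> n" "2 \<le> m"
  interpret occupancy n m d by unfold_locales (use assms nm in auto)
  have Y: "occY n m d = occF n m d" by (simp add: fun_eq_iff occY_eq_occF)
  have mean: "occ_mean n m d = avg P (occF n m d)"
    by (simp add: occ_mean_def occ_space_def avg_def Y)
  have sigma: "occ_sigma n m d = sqrt (var P (occF n m d))"
    by (simp add: occ_sigma_def occ_var_def occ_space_def mean var_def Y) (simp add: avg_def)
  have cdf: "occ_cdf n m d z =
      avg P (\<lambda>x. of_bool ((occF n m d x - avg P (occF n m d)) / sqrt (var P (occF n m d)) \<le> z))" for z
    using fin_P(1) by (simp add: occ_cdf_def occ_W_def occ_space_def mean sigma Y) (simp add: avg_def Int_def)
  \<comment> \<open>The constant was left open before \<open>n\<close> and \<open>m\<close> were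
    fixed; outside the locale \<open>K\<close> takes \<open>d\<close> as its only argument, so it is
    an admissible witness.\<close>
  show "(SUP z. \<bar>occ_cdf n m d z - Phi z\<bar>) \<le> 16 * sqrt (12288 * occupancy.K d * (real d + 1)) / occ_r n m d"
  proof (rule cSUP_least)
    fix z
    show "\<bar>occ_cdf n m d z - Phi z\<bar> \<le> 16 * sqrt (12288 * occupancy.K d * (real d + 1)) / occ_r n m d"
      using berry_esseen[of z] by (simp add: cdf occ_r_def sigma lam_def)
  qed simp
qed

end
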